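(* Let $\mathbb C\subset M_n(\mathbb C)$ be the inclusion, $\{\Phi_t\}_{t\ge0}$, $\Phi_t=e^{-t\mathcal L}$, a bimodule GNS symmetric quantum Markov semigroup, and $\beta\in\mathbb R\setminus\{0\}$. For $x\in M_n(\mathbb C)$ write $A(x)=\frac12\left\{x,\,1*(\overline{\widehat{\mathcal L}_0}-\widehat{\mathcal L}_0)\right\}$, and for $t>0$ let $d\nu_t(s)=\frac{2\beta e^{-2\beta s}}{1-e^{-2\beta t}}\,ds$ on $[0,t]$ (so $\int_0^td\nu_t(s)=1$). Then the following are equivalent. (a) For all $x\in M_n(\mathbb C)$ and $t>0$, $$\Gamma(\Phi_t(x))\le e^{-2\beta t}\Phi_t(\Gamma(x))-\frac{1-e^{-2\beta t}}{\beta\sum_{j=1}^m(1+\mu_j)^2}\left|\mathcal L(\Phi_t(x))+\int_0^t\Big(\Phi_s\mathcal L^*(\Phi_{t-s}(x))+\Phi_s\big(A(\Phi_{t-s}(x))\big)\Big)d\nu_t(s)\right|^2 .$$ (b) For all $x\in M_n(\mathbb C)$, $$\Gamma_2(x)\ge\beta\,\Gamma(x)+\frac{1}{\sum_{j=1}^m(1+\mu_j)^2}\left|\mathcal L(x)+\mathcal L^*(x)+A(x)\right|^2 .$$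
   Context: Setting for the inclusion $\mathcal N=\mathbb C\subset\mathcal M=M_n(\mathbb C)$: $\tau$ is the normalized trace, $\lambda=n^{-2}$, $e_1$ the projection of $L^2(\mathcal M,\tau)$ onto $\mathbb C1$, $\mathcal M_1=\langle\mathcal M,e_1\rangle$, and $\mathcal M\subset\mathcal M_1\subset\mathcal M_2\subset\cdots$ the Jones tower with $\mathcal M_k=\langle\mathcal M_{k-1},e_k\rangle$ and Markov traces. $\mathbb E_{\mathcal A}$ is the trace-preserving conditional expectation onto $\mathcal A$, $J_1$ the conjugation of $L^2(\mathcal M_1,\tau_1)$, $\mathcal R(a)$ the range projection, $\{a,b\}=ab+ba$, $|a|^2=a^*a$, and $\mathcal L^*$ the adjoint for $\langle x,y\rangle=\tau(y^*x)$. For $a\in\mathcal M'\cap\mathcal M_2$: $\overline a=J_1a^*J_1$ and $x*a=\lambda^{-5/2}\mathbb E_{\mathcal M}(e_2e_1a\,x\,e_1e_2)$, $x\in\mathcal M$. Each linear map $\Phi$ on $\mathcal M$ has a unique Fourier multiplier $\widehat\Phi\in\mathcal M'\cap\mathcal M_2$ with $\Phi(x)=x*\widehat\Phi$. A quantum Markov semigroup is a continuous semigroup $\Phi_t=e^{-t\mathcal L}$ of unital completely positive maps; $\widehat{\mathcal L}_0=-(1-e_2)\widehat{\mathcal L}(1-e_2)\ge0$. It is bimodule GNS symmetric if each $\Phi_t$ is equilibrium (has a faithful invariant state) and there is a strictly positive $\widehat\Delta\in\mathcal M'\cap\mathcal M_2$ with $\widehat\Delta e_2=e_2$ and $\overline{\widehat{\mathcal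 L}}=\overline{\widehat\Delta}\,\widehat{\mathcal L}$. Then $\widehat{\mathcal L}_0$ and $\mathcal R(\widehat{\mathcal L}_0)\widehat\Delta$ generate an abelian algebra with minimal projections $p_1,\dots,p_m$, and $\mu_1,\dots,\mu_m>0$ are defined by $\widehat\Delta=\sum_{j=1}^m\mu_jp_j+1-\mathcal R(\widehat{\mathcal L}_0)$. $\Gamma(x,y)=\frac12(x^*\mathcal L(y)+\mathcal L(x)^*y-\mathcal L(x^*y))$, $\Gamma_2(x,y)=\frac12(\Gamma(x,\mathcal L(y))+\Gamma(\mathcal L(x),y)-\mathcal L(\Gamma(x,y)))$, $\Gamma(x)=\Gamma(x,x)$, $\Gamma_2(x)=\Gamma_2(x,x)$. *)

theory Defs
  imports "HOL-Analysis.Analysis"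
begin

section \<open>Complex matrices\<close>

type_synonym 'k cmat = "complex ^ 'k ^ 'k"

definition cscale :: "complex \<Rightarrow> 'k::finite cmat \<Rightarrow> 'k cmat"
  where "cscale c a = (\<chi> i j. c * a $ i $ j)"

definition cadj :: "'k::finite cmat \<Rightarrow> 'k cmat"
  where "cadj a = (\<chi> i j. cnj (a $ j $ i))"

definition cdot :: "complex ^ 'k::finite \<Rightarrow> complex ^ 'k \<Rightarrow> complex"
  where "cdot \<xi> \<eta> = (\<Sum>i\<in>UNIV. \<xi> $ i * cnj (\<eta> $ i))"

definition psd :: "'k::finite cmat \<Rightarrow> bool"
  where "psd a \<longleftrightarrow> (\<forall>\<xi>. cdot (a *v \<xi>) \<xi> \<in> \<real>\<^sub>\<ge>\<^sub>0)"

definition strictly_positive :: "'k::finite cmat \<Rightarrow> bool"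
  where "strictly_positive a \<longleftrightarrow> (\<forall>\<xi>. \<xi> \<noteq> 0 \<longrightarrow> cdot (a *v \<xi>) \<xi> \<in> \<real>\<^sub>\<ge>\<^sub>0 - {0})"

definition loewner_le :: "'k::finite cmat \<Rightarrow> 'k cmat \<Rightarrow> bool"  (infix \<open>\<preceq>\<close> 50)
  where "a \<preceq> b \<longleftrightarrow> psd (b - a)"

definition abs_sq :: "'k::finite cmat \<Rightarrow> 'k cmat"
  where "abs_sq a = cadj a ** a"

definition anticomm :: "'k::finite cmat \<Rightarrow> 'k cmat \<Rightarrow> 'k cmat"
  where "anticomm a b = a ** b + b ** a"

text \<open>The normalized trace.\<close>

definition ntr :: "'k::finite cmat \<Rightarrow> complex"
  where "ntr a = trace a / of_nat CARD('k)"

definition orth_proj :: "(complex ^ 'k::finite) set \<Rightarrow> 'k cmat"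
  where "orth_proj S = (THE P. cadj P = P \<and> P ** P = P \<and> range ((*v) P) = S)"

definition range_proj :: "'k::finite cmat \<Rightarrow> 'k cmat"
  where "range_proj a = orth_proj (range ((*v) a))"

text \<open>The generated \<open>*\<close>-algebra is not required to contain the identity matrix.\<close>

inductive_set star_alg :: "'k::finite cmat set \<Rightarrow> 'k cmat set" for S
  where
    gen: "a \<in> S \<Longrightarrow> a \<in> star_alg S"
  | zero: "0 \<in> star_alg S"
  | add: "a \<in> star_alg S \<Longrightarrow> b \<in> star_alg S \<Longrightarrow> a + b \<in> star_alg S"
  | scale: "a \<in> star_alg S \<Longrightarrow> cscale c a \<in> star_alg S"
  | mult: "a \<in> star_alg S \<Longrightarrow> b \<in> star_alg S \<Longrightarrow> a ** b \<in> star_alg S"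
  | adj: "a \<in> star_alg S \<Longrightarrow> cadj a \<in> star_alg S"

definition projections :: "'k::finite cmat set \<Rightarrow> 'k cmat set"
  where "projections A = {p \<in> A. cadj p = p \<and> p ** p = p}"

definition minimal_projections :: "'k::finite cmat set \<Rightarrow> 'k cmat set"
  where "minimal_projections A =
    {p \<in> projections A. p \<noteq> 0 \<and> (\<forall>q\<in>projections A. q \<preceq> p \<longrightarrow> q = 0 \<or> q = p)}"

section \<open>The Jones tower of the scalars in the full matrix algebra\<close>

text \<open>
  Let \<open>B\<close> be the full algebra of matrices indexed by \<open>'k\<close>, with normalized trace. The map
  \<open>L2vec\<close> identifies \<open>L\<^sup>2(B, ntr)\<close>, whose inner product is \<open>ntr (y\<^sup>* x)\<close>, isometrically with
  the standard Hilbert space indexed by \<open>'k \<times> 'k\<close>; this is the reason for the square root.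
  Operators on \<open>L\<^sup>2(B, ntr)\<close> are thereby matrices indexed by \<open>'k \<times> 'k\<close>, \<open>lmult\<close> is the
  representation of \<open>B\<close> by left multiplication, and \<open>J_conj\<close> is the conjugation \<open>x \<mapsto> x\<^sup>*\<close>.
\<close>

definition L2vec :: "'k::finite cmat \<Rightarrow> complex ^ ('k \<times> 'k)"
  where "L2vec x = (\<chi> p. x $ fst p $ snd p / of_real (sqrt (real CARD('k))))"

definition L2mat :: "complex ^ ('k::finite \<times> 'k) \<Rightarrow> 'k cmat"
  where "L2mat \<xi> = (\<chi> i j. of_real (sqrt (real CARD('k))) * \<xi> $ (i, j))"

definition lmult :: "'k::finite cmat \<Rightarrow> ('k \<times> 'k) cmat"
  where "lmult a = matrix (\<lambda>\<xi>. L2vec (a ** L2mat \<xi>))"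

definition J_conj :: "complex ^ ('k::finite \<times> 'k) \<Rightarrow> complex ^ ('k \<times> 'k)"
  where "J_conj \<xi> = L2vec (cadj (L2mat \<xi>))"

text \<open>
  \<open>M\<close> is the type \<open>'n cmat\<close>. The algebra \<open>M\<^sub>1\<close> acts on \<open>L\<^sup>2(M)\<close> and is all of \<open>B(L\<^sup>2(M))\<close>
  (see \<open>jones_M1_eq_UNIV\<close>), so its Markov trace is \<open>ntr\<close> and \<open>L\<^sup>2(M\<^sub>1, \<tau>\<^sub>1)\<close> is obtained by
  applying \<open>L2vec\<close> once more. \<open>M\<^sub>2\<close> is a factor acting on \<open>L\<^sup>2(M\<^sub>1, \<tau>\<^sub>1)\<close>, and its Markov
  trace is the restriction of \<open>ntr\<close>; cf. \<open>ntr_lmult\<close>, \<open>ntr_lmult_jones_e1\<close> and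
  \<open>ntr_lmult_jones_e2\<close>.
\<close>

definition jones_e1 :: "('n::finite \<times> 'n) cmat"
  where "jones_e1 = orth_proj (L2vec ` range (\<lambda>c. mat c))"

definition jones_M1 :: "('n::finite \<times> 'n) cmat set"
  where "jones_M1 = star_alg (insert jones_e1 (range lmult))"

definition jones_e2 :: "(('n::finite \<times> 'n) \<times> ('n \<times> 'n)) cmat"
  where "jones_e2 = orth_proj (L2vec ` range (lmult :: 'n cmat \<Rightarrow> _))"

definition jones_M2 :: "(('n::finite \<times> 'n) \<times> ('n \<times> 'n)) cmat set"
  where "jones_M2 = star_alg (insert jones_e2 (lmult ` jones_M1))"

text \<open>The constant \<open>\<lambda>\<close> of the Markov traces.\<close>

definition jones_index_inv :: "'n::finite itself \<Rightarrow> real"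
  where "jones_index_inv _ = 1 / (real CARD('n))\<^sup>2"

lemma lmult_nth: "lmult a $ p $ q = (if snd p = snd q then a $ fst p $ fst q else 0)"
proof -
  let ?c = "complex_of_real (sqrt (real CARD('a)))"
  have c: "?c \<noteq> 0" by simp
  have "(\<Sum>k\<in>UNIV. a $ fst p $ k * (?c * (if (k, snd p) = q then 1 else 0))) / ?c
      = (\<Sum>k\<in>UNIV. if k = fst q then (if snd p = snd q then a $ fst p $ k else 0) else 0)"
    unfolding sum_divide_distrib using c by (intro sum.cong) (auto simp: prod_eq_iff)
  also have "\<dots> = (if snd p = snd q then a $ fst p $ fst q else 0)"
    by simp
  finally show ?thesis
    by (simp add: lmult_def matrix_def L2vec_def L2mat_def matrix_matrix_mult_def axis_def eq_commute)
qed

lemma ntr_lmult: "ntr (lmult a) = ntr a"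
proof -
  have "trace (lmult a) = (\<Sum>i\<in>UNIV. \<Sum>j::'a\<in>UNIV. a $ i $ i)"
    unfolding trace_def by (simp add: lmult_nth sum.cartesian_product UNIV_Times_UNIV[symmetric]
        case_prod_beta del: UNIV_Times_UNIV sum_constant)
  also have "\<dots> = of_nat CARD('a) * trace a"
    by (simp add: trace_def sum_distrib_left)
  finally show ?thesis by (simp add: ntr_def)
qed

lemma cadj_mult: "cadj (a ** b) = cadj b ** cadj a"
  by (simp add: cadj_def matrix_matrix_mult_def vec_eq_iff mult.commute)

lemma orth_proj_eqI:
  assumes "cadj P = P" "P ** P = P" "range ((*v) P) = S"
  shows "orth_proj S = P"
  unfolding orth_proj_def
proof (rule the_equality)
  fix Q assume Q: "cadj Q = Q \<and> Q ** Q = Q \<and> range ((*v) Q) = S"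
  have fix_by: "A ** B = B"
    if AA: "A ** A = A" and r: "range ((*v) A) = range ((*v) B)" for A B :: "'a cmat"
  proof -
    have "(A ** B) *v \<xi> = B *v \<xi>" for \<xi>
    proof -
      obtain \<eta> where "B *v \<xi> = A *v \<eta>" using r by (metis rangeE rangeI)
      then show ?thesis using AA by (metis matrix_vector_mul_assoc)
    qed
    then show ?thesis by (simp add: matrix_eq)
  qed
  have PQ: "P ** Q = Q" and QP: "Q ** P = P"
    using assms(2,3) Q by (simp_all only: fix_by)
  have "Q = cadj (P ** Q)" using PQ Q by simp
  also have "\<dots> = Q ** P" using assms(1) Q by (simp only: cadj_mult)
  finally show "Q = P" using QP by simp
qed (use assms in auto)

lemma sum_UNIV_prod: "(\<Sum>p\<in>UNIV. f p) = (\<Sum>i::'a::finite\<in>UNIV. \<Sum>j::'b::finite\<in>UNIV. f (i, j))"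
  unfolding UNIV_Times_UNIV[symmetric] by (simp add: sum.cartesian_product del: UNIV_Times_UNIV)

lemma jones_e1_nth:
  "(jones_e1 :: ('n::finite \<times> 'n) cmat) $ p $ q =
    (if fst p = snd p \<and> fst q = snd q then 1 / of_nat CARD('n) else 0)"
proof -
  let ?n = "of_nat CARD('n) :: complex"
  let ?s = "complex_of_real (sqrt (real CARD('n)))"
  define P :: "('n \<times> 'n) cmat" where
    "P = (\<chi> p q. if fst p = snd p \<and> fst q = snd q then 1 / ?n else 0)"
  have S: "(\<Sum>q\<in>UNIV. if fst q = snd q then f q else 0) = (\<Sum>i\<in>UNIV. f (i, i))"
    for f :: "'n \<times> 'n \<Rightarrow> complex"
    by (simp add: sum_UNIV_prod)
  have s: "?s \<noteq> 0" by simp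
  have Pv: "P *v \<xi> = L2vec (mat ((\<Sum>i\<in>UNIV. \<xi> $ (i, i)) / ?n * ?s))" for \<xi>
  proof (rule vec_eq_iff[THEN iffD2], rule allI)
    fix p
    have "(P *v \<xi>) $ p = (if fst p = snd p then
        (\<Sum>q\<in>UNIV. if fst q = snd q then \<xi> $ q / ?n else 0) else 0)"
      by (auto simp: matrix_vector_mult_def P_def intro!: sum.cong sum.neutral)
    then show "(P *v \<xi>) $ p = L2vec (mat ((\<Sum>i\<in>UNIV. \<xi> $ (i, i)) / ?n * ?s)) $ p"
      unfolding S using s by (simp add: L2vec_def mat_def sum_divide_distrib)
  qed
  have "orth_proj (L2vec ` range (\<lambda>c. mat c)) = P"
  proof (rule orth_proj_eqI)
    show "cadj P = P" by (auto simp: cadj_def P_def vec_eq_iff)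
    have tr: "(\<Sum>i\<in>UNIV. L2vec (mat c :: 'n cmat) $ (i, i)) = ?n * c / ?s" for c
      by (simp add: L2vec_def mat_def)
    have idem: "P *v L2vec (mat c) = L2vec (mat c)" for c
      unfolding Pv tr using s by simp
    have "P *v (P *v \<xi>) = P *v \<xi>" for \<xi>
      unfolding Pv[of \<xi>] by (rule idem)
    then show "P ** P = P"
      by (simp only: matrix_eq matrix_vector_mul_assoc[symmetric] simp_thms)
    show "range ((*v) P) = L2vec ` range (\<lambda>c. mat c)"
    proof (intro equalityI subsetI)
      fix y assume "y \<in> L2vec ` range (\<lambda>c. mat c :: 'n cmat)"
      then have "y = P *v y" using idem by auto
      then show "y \<in> range ((*v) P)" by (rule range_eqI)
    next
      fix y assume "y \<in> range ((*v) P)"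
      then obtain \<xi> where "y = P *v \<xi>" by (rule rangeE)
      then show "y \<in> L2vec ` range (\<lambda>c. mat c)" by (simp only: Pv) (rule imageI[OF rangeI])
    qed
  qed
  then show ?thesis by (simp add: jones_e1_def P_def)
qed

lemma jones_e2_nth:
  "(jones_e2 :: (('n::finite \<times> 'n) \<times> ('n \<times> 'n)) cmat) $ p $ q =
    (if snd (fst p) = snd (snd p) \<and> snd (fst q) = snd (snd q) \<and>
        fst (fst p) = fst (fst q) \<and> fst (snd p) = fst (snd q)
     then 1 / of_nat CARD('n) else 0)"
proof -
  let ?n = "of_nat CARD('n) :: complex"
  let ?s = "complex_of_real (sqrt (real CARD('n \<times> 'n)))"
  define P :: "(('n \<times> 'n) \<times> ('n \<times> 'n)) cmat" where
    "P = (\<chi> p q. if snd (fst p) = snd (snd p) \<and> snd (fst q) = snd (snd q) \<and>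
        fst (fst p) = fst (fst q) \<and> fst (snd p) = fst (snd q) then 1 / ?n else 0)"
  define m :: "complex ^ (('n \<times> 'n) \<times> ('n \<times> 'n)) \<Rightarrow> 'n cmat" where
    "m = (\<lambda>\<xi>. \<chi> i k. (\<Sum>j\<in>UNIV. \<xi> $ ((i, j), (k, j))) / ?n * ?s)"
  have s: "?s \<noteq> 0" by simp
  have Pv: "P *v \<xi> = L2vec (lmult (m \<xi>))" for \<xi>
  proof (rule vec_eq_iff[THEN iffD2], rule allI)
    fix p :: "('n \<times> 'n) \<times> ('n \<times> 'n)"
    obtain i j k l where p: "p = ((i, j), (k, l))" by (metis surj_pair)
    let ?X = "\<lambda>j'. if j = l then \<xi> $ ((i, j'), (k, j')) / ?n else 0"
    have "(P *v \<xi>) $ p = (\<Sum>q\<in>UNIV. \<Sum>j'\<in>UNIV. if q = ((i, j'), (k, j')) then ?X j' else 0)"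
      unfolding matrix_vector_mult_def vec_lambda_beta
    proof (rule sum.cong[OF refl])
      fix q :: "('n \<times> 'n) \<times> ('n \<times> 'n)"
      obtain a b c d where q: "q = ((a, b), (c, d))" by (metis surj_pair)
      have "(\<Sum>j'\<in>UNIV. if q = ((i, j'), (k, j')) then ?X j' else 0)
          = (\<Sum>j'\<in>UNIV. if j' = b then (if a = i \<and> c = k \<and> d = b then ?X b else 0) else 0)"
        by (rule sum.cong[OF refl]) (auto simp: q)
      also have "\<dots> = P $ p $ q * \<xi> $ q"
        by (simp add: P_def p q)
      finally show "P $ p $ q * \<xi> $ q
          = (\<Sum>j'\<in>UNIV. if q = ((i, j'), (k, j')) then ?X j' else 0)" by simp
    qed
    also have "\<dots> = (\<Sum>j'\<in>UNIV. \<Sum>q\<in>UNIV. if q = ((i, j'), (k, j')) then ?X j' else 0)"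
      by (rule sum.swap)
    also have "\<dots> = (if j = l then (\<Sum>j'\<in>UNIV. \<xi> $ ((i, j'), (k, j'))) / ?n else 0)"
      by (simp add: sum_divide_distrib)
    finally show "(P *v \<xi>) $ p = L2vec (lmult (m \<xi>)) $ p"
      using s by (simp add: L2vec_def lmult_nth m_def p)
  qed
  have "orth_proj (L2vec ` range (lmult :: 'n cmat \<Rightarrow> _)) = P"
  proof (rule orth_proj_eqI)
    show "cadj P = P" by (auto simp: cadj_def P_def vec_eq_iff)
    have "m (L2vec (lmult x)) = x" for x :: "'n cmat"
      using s by (simp add: m_def L2vec_def lmult_nth vec_eq_iff)
    then have idem: "P *v L2vec (lmult x) = L2vec (lmult x)" for x
      by (simp add: Pv)
    have "P *v (P *v \<xi>) = P *v \<xi>" for \<xi>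
      unfolding Pv[of \<xi>] by (rule idem)
    then show "P ** P = P"
      by (simp only: matrix_eq matrix_vector_mul_assoc[symmetric] simp_thms)
    show "range ((*v) P) = L2vec ` range (lmult :: 'n cmat \<Rightarrow> _)"
    proof (intro equalityI subsetI)
      fix y assume "y \<in> L2vec ` range (lmult :: 'n cmat \<Rightarrow> _)"
      then have "y = P *v y" using idem by auto
      then show "y \<in> range ((*v) P)" by (rule range_eqI)
    next
      fix y assume "y \<in> range ((*v) P)"
      then obtain \<xi> where "y = P *v \<xi>" by (rule rangeE)
      then show "y \<in> L2vec ` range (lmult :: 'n cmat \<Rightarrow> _)" by (simp only: Pv) (rule imageI[OF rangeI])
    qed
  qed
  then show ?thesis by (simp add: jones_e2_def P_def)
qed

lemma ntr_lmult_jones_e1: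
  "ntr (lmult (a :: 'n::finite cmat) ** jones_e1) = jones_index_inv TYPE('n) * ntr a"
proof -
  have "trace (lmult a ** jones_e1) = (\<Sum>i\<in>UNIV. \<Sum>j\<in>UNIV. \<Sum>k\<in>UNIV. \<Sum>l\<in>UNIV.
      if l = j then if k = j then if j = i then a $ i $ i / of_nat CARD('n) else 0 else 0 else 0)"
    unfolding trace_def matrix_matrix_mult_def sum_UNIV_prod vec_lambda_beta
    by (intro sum.cong refl) (auto simp: lmult_nth jones_e1_nth)
  also have "\<dots> = trace a / of_nat CARD('n)"
    by (simp add: trace_def sum_divide_distrib)
  finally show ?thesis by (simp add: ntr_def jones_index_inv_def power2_eq_square)
qed

lemma ntr_lmult_jones_e2:
  "ntr (lmult (a :: ('n::finite \<times> 'n) cmat) ** jones_e2) = jones_index_inv TYPE('n) * ntr a"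
proof -
  have diag: "(lmult a ** jones_e2) $ p $ p =
      (if snd (snd p) = snd (fst p) then a $ fst p $ fst p / of_nat CARD('n) else 0)" for p
  proof -
    have "(lmult a ** jones_e2) $ p $ p = (\<Sum>q\<in>UNIV. if q = p then
        (if snd (snd p) = snd (fst p) then a $ fst p $ fst p / of_nat CARD('n) else 0) else 0)"
      unfolding matrix_matrix_mult_def vec_lambda_beta
      by (intro sum.cong refl) (auto simp: lmult_nth jones_e2_nth prod_eq_iff)
    then show ?thesis by simp
  qed
  have "trace (lmult a ** jones_e2) = trace a"
    unfolding trace_def diag sum_UNIV_prod by simp
  then show ?thesis by (simp add: ntr_def jones_index_inv_def power2_eq_square)
qed

lemma jones_M1_eq_UNIV: "jones_M1 = UNIV"
proof -
  let ?E = "\<lambda>i j. (\<chi> r s. if r = i \<and> s = j then 1 else 0) :: 'a cmat"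
  let ?u = "\<lambda>p q. lmult (?E (fst p) (snd p)) ** jones_e1 ** lmult (?E (snd q) (fst q))"
  have sum_in: "(\<Sum>i\<in>I. f i) \<in> jones_M1" if "finite I" "\<And>i. f i \<in> jones_M1"
    for f :: "'i \<Rightarrow> ('a \<times> 'a) cmat" and I
    using that unfolding jones_M1_def
    by (induction I rule: finite_induct) (auto intro: star_alg.intros)
  have u: "?u p q $ r $ s = (if r = p \<and> s = q then 1 / of_nat CARD('a) else 0)" for p q r s
  proof -
    obtain i j k l where pq: "p = (i, j)" "q = (k, l)" by fastforce
    obtain r1 r2 s1 s2 where rs: "r = (r1, r2)" "s = (s1, s2)" by fastforce
    have "?u p q $ r $ s = (\<Sum>v1\<in>UNIV. \<Sum>v2\<in>UNIV. \<Sum>w1\<in>UNIV. \<Sum>w2\<in>UNIV.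
        if w2 = w1 then if w1 = j then if v2 = v1 then if v1 = l then
          (if r = p \<and> s = q then 1 / of_nat CARD('a) else 0) else 0 else 0 else 0 else 0)"
      unfolding matrix_matrix_mult_def sum_UNIV_prod vec_lambda_beta sum_distrib_right
      by (intro sum.cong refl) (auto simp: lmult_nth jones_e1_nth pq rs)
    also have "\<dots> = (if r = p \<and> s = q then 1 / of_nat CARD('a) else 0)"
      by simp
    finally show ?thesis .
  qed
  have "a \<in> jones_M1" for a :: "('a \<times> 'a) cmat"
  proof -
    have "?u p q \<in> jones_M1" for p q
      unfolding jones_M1_def by (intro star_alg.mult star_alg.gen) auto
    then have "(\<Sum>p\<in>UNIV. \<Sum>q\<in>UNIV. cscale (of_nat CARD('a) * a $ p $ q) (?u p q)) \<in> jones_M1"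
      by (intro sum_in) (auto simp: jones_M1_def intro: star_alg.scale)
    moreover have "(\<Sum>p\<in>UNIV. \<Sum>q\<in>UNIV. cscale (of_nat CARD('a) * a $ p $ q) (?u p q)) = a"
    proof -
      have "(\<Sum>p\<in>UNIV. \<Sum>q\<in>UNIV. cscale (of_nat CARD('a) * a $ p $ q) (?u p q)) $ r $ s = a $ r $ s"
        for r s
      proof -
        have "(\<Sum>p\<in>UNIV. \<Sum>q\<in>UNIV. cscale (of_nat CARD('a) * a $ p $ q) (?u p q)) $ r $ s =
          (\<Sum>p\<in>UNIV. \<Sum>q\<in>UNIV. if q = s then if p = r then a $ r $ s else 0 else 0)"
          unfolding cscale_def sum_component vec_lambda_beta u
          by ((rule sum.cong[OF refl])+) auto
        then show ?thesis by simp
      qed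
      then show ?thesis by (simp add: vec_eq_iff)
    qed
    ultimately show ?thesis by metis
  qed
  then show ?thesis by blast
qed

definition M_in_M2 :: "'n::finite cmat \<Rightarrow> (('n \<times> 'n) \<times> ('n \<times> 'n)) cmat"
  where "M_in_M2 x = lmult (lmult x)"

definition rel_commutant :: "(('n::finite \<times> 'n) \<times> ('n \<times> 'n)) cmat set"
  where "rel_commutant = {a \<in> jones_M2. \<forall>x. a ** M_in_M2 x = M_in_M2 x ** a}"

text \<open>
  Trace-preserving conditional expectations of \<open>M\<^sub>2\<close> onto \<open>M\<close>. The image is identified with \<open>M\<close>,
  and the value \<open>0\<close> outside \<open>M\<^sub>2\<close> only serves to make \<open>E\<close> unique as a total function.
\<close>

definition is_cond_exp :: "((('n::finite \<times> 'n) \<times> ('n \<times> 'n)) cmat \<Rightarrow> 'n cmat) \<Rightarrow> bool"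
  where "is_cond_exp E \<longleftrightarrow>
    (\<forall>a\<in>jones_M2. \<forall>b\<in>jones_M2. E (a + b) = E a + E b) \<and>
    (\<forall>c. \<forall>a\<in>jones_M2. E (cscale c a) = cscale c (E a)) \<and>
    (\<forall>a\<in>jones_M2. psd a \<longrightarrow> psd (E a)) \<and>
    (\<forall>x. E (M_in_M2 x) = x) \<and>
    (\<forall>a\<in>jones_M2. \<forall>x y. E (M_in_M2 x ** a ** M_in_M2 y) = x ** E a ** y) \<and>
    (\<forall>a\<in>jones_M2. ntr (E a) = ntr a) \<and>
    (\<forall>a. a \<notin> jones_M2 \<longrightarrow> E a = 0)"

definition cond_exp_M :: "(('n::finite \<times> 'n) \<times> ('n \<times> 'n)) cmat \<Rightarrow> 'n cmat"
  where "cond_exp_M = (THE E. is_cond_exp E)"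

text \<open>In \<open>conv\<close>, \<open>e\<^sub>1\<close> is viewed in \<open>M\<^sub>2\<close> through \<open>lmult\<close>.\<close>

definition conv :: "'n::finite cmat \<Rightarrow> (('n \<times> 'n) \<times> ('n \<times> 'n)) cmat \<Rightarrow> 'n cmat"
  where "conv x a = (jones_index_inv TYPE('n) powr (- (5 / 2))) *\<^sub>R
    cond_exp_M (jones_e2 ** lmult jones_e1 ** a ** M_in_M2 x ** lmult jones_e1 ** jones_e2)"

text \<open>The linear operator \<open>J\<^sub>1 a\<^sup>* J\<^sub>1\<close> on \<open>L\<^sup>2(M\<^sub>1, \<tau>\<^sub>1)\<close>.\<close>

definition bar :: "('k::finite \<times> 'k) cmat \<Rightarrow> ('k \<times> 'k) cmat"
  where "bar a = matrix (\<lambda>\<xi>. J_conj (cadj a *v J_conj \<xi>))"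

definition fourier_mult ::
    "('n::finite cmat \<Rightarrow> 'n cmat) \<Rightarrow> (('n \<times> 'n) \<times> ('n \<times> 'n)) cmat"
  where "fourier_mult \<Phi> = (THE a. a \<in> rel_commutant \<and> (\<forall>x. \<Phi> x = conv x a))"

section \<open>Bimodule GNS symmetric quantum Markov semigroups\<close>

definition clinear_map :: "('n::finite cmat \<Rightarrow> 'n cmat) \<Rightarrow> bool"
  where "clinear_map \<Phi> \<longleftrightarrow> Vector_Spaces.linear cscale cscale \<Phi>"

text \<open>Positivity of the \<open>k \<times> k\<close> block matrix with blocks \<open>a i j\<close>, \<open>i, j < k\<close>.\<close>

definition block_psd :: "nat \<Rightarrow> (nat \<Rightarrow> nat \<Rightarrow> 'n::finite cmat) \<Rightarrow> bool"
  where "block_psd k a \<longleftrightarrow>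
    (\<forall>\<xi> :: nat \<Rightarrow> complex ^ 'n. (\<Sum>i<k. \<Sum>j<k. cdot (a i j *v \<xi> j) (\<xi> i)) \<in> \<real>\<^sub>\<ge>\<^sub>0)"

definition completely_positive :: "('n::finite cmat \<Rightarrow> 'n cmat) \<Rightarrow> bool"
  where "completely_positive \<Phi> \<longleftrightarrow> clinear_map \<Phi> \<and>
    (\<forall>k a. block_psd k a \<longrightarrow> block_psd k (\<lambda>i j. \<Phi> (a i j)))"

definition exp_map :: "('n::finite cmat \<Rightarrow> 'n cmat) \<Rightarrow> 'n cmat \<Rightarrow> 'n cmat"
  where "exp_map T x = (\<Sum>k. (1 / fact k) *\<^sub>R (T ^^ k) x)"

definition quantum_Markov_semigroup ::
    "(real \<Rightarrow> 'n::finite cmat \<Rightarrow> 'n cmat) \<Rightarrow> ('n cmat \<Rightarrow> 'n cmat) \<Rightarrow> bool"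
  where "quantum_Markov_semigroup \<Phi> \<L> \<longleftrightarrow>
    (\<forall>t\<ge>0. completely_positive (\<Phi> t) \<and> \<Phi> t (mat 1) = mat 1) \<and>
    \<Phi> 0 = id \<and> (\<forall>s\<ge>0. \<forall>t\<ge>0. \<Phi> (s + t) = \<Phi> s \<circ> \<Phi> t) \<and>
    (\<forall>x. continuous_on {0..} (\<lambda>t. \<Phi> t x)) \<and>
    clinear_map \<L> \<and> (\<forall>t\<ge>0. \<Phi> t = exp_map (\<lambda>x. - (t *\<^sub>R \<L> x)))"

definition faithful_state :: "('n::finite cmat \<Rightarrow> complex) \<Rightarrow> bool"
  where "faithful_state \<phi> \<longleftrightarrow> Vector_Spaces.linear cscale (*) \<phi> \<and> \<phi> (mat 1) = 1 \<and>
    (\<forall>a. psd a \<longrightarrow> \<phi> a \<in> \<real>\<^sub>\<ge>\<^sub>0 \<and> (\<phi> a = 0 \<longrightarrow> a = 0))"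

definition equilibrium :: "('n::finite cmat \<Rightarrow> 'n cmat) \<Rightarrow> bool"
  where "equilibrium \<Phi> \<longleftrightarrow> (\<exists>\<phi>. faithful_state \<phi> \<and> (\<forall>x. \<phi> (\<Phi> x) = \<phi> x))"

text \<open>Bimodule GNS symmetry, with the witness \<open>\<Delta>\<close> made explicit.\<close>

definition bimodule_GNS_symmetric ::
    "(real \<Rightarrow> 'n::finite cmat \<Rightarrow> 'n cmat) \<Rightarrow> ('n cmat \<Rightarrow> 'n cmat) \<Rightarrow>
      (('n \<times> 'n) \<times> ('n \<times> 'n)) cmat \<Rightarrow> bool"
  where "bimodule_GNS_symmetric \<Phi> \<L> \<Delta> \<longleftrightarrow>
    (\<forall>t\<ge>0. equilibrium (\<Phi> t)) \<and>
    \<Delta> \<in> rel_commutant \<and> strictly_positive \<Delta> \<and> \<Delta> ** jones_e2 = jones_e2 \<and>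
    bar (fourier_mult \<L>) = bar \<Delta> ** fourier_mult \<L>"

definition L0_hat :: "('n::finite cmat \<Rightarrow> 'n cmat) \<Rightarrow> (('n \<times> 'n) \<times> ('n \<times> 'n)) cmat"
  where "L0_hat \<L> = - ((mat 1 - jones_e2) ** fourier_mult \<L> ** (mat 1 - jones_e2))"

text \<open>
  \<open>p\<close> enumerates the minimal projections without repetition. The unit of the generated algebra is
  the range projection of \<open>L0_hat \<L>\<close>, not the identity. If \<open>L0_hat \<L> = 0\<close> then \<open>m = 0\<close>.
\<close>

definition modular_data ::
    "('n::finite cmat \<Rightarrow> 'n cmat) \<Rightarrow> (('n \<times> 'n) \<times> ('n \<times> 'n)) cmat \<Rightarrow>
      nat \<Rightarrow> (nat \<Rightarrow> (('n \<times> 'n) \<times> ('n \<times> 'n)) cmat) \<Rightarrow> (nat \<Rightarrow> real) \<Rightarrow> bool"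
  where "modular_data \<L> \<Delta> m p \<mu> \<longleftrightarrow>
    bij_betw p {1..m}
      (minimal_projections (star_alg {L0_hat \<L>, range_proj (L0_hat \<L>) ** \<Delta>})) \<and>
    (\<forall>j\<in>{1..m}. 0 < \<mu> j) \<and>
    \<Delta> = (\<Sum>j=1..m. \<mu> j *\<^sub>R p j) + mat 1 - range_proj (L0_hat \<L>)"

section \<open>Gradient forms\<close>

definition L2_adjoint :: "('n::finite cmat \<Rightarrow> 'n cmat) \<Rightarrow> 'n cmat \<Rightarrow> 'n cmat"
  where "L2_adjoint \<L> =
    (THE \<L>'. \<forall>x y. ntr (cadj y ** \<L> x) = ntr (cadj (\<L>' y) ** x))"

definition grad_form ::
    "('n::finite cmat \<Rightarrow> 'n cmat) \<Rightarrow> 'n cmat \<Rightarrow> 'n cmat \<Rightarrow> 'n cmat"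
  where "grad_form \<L> x y =
    (1 / 2) *\<^sub>R (cadj x ** \<L> y + cadj (\<L> x) ** y - \<L> (cadj x ** y))"

definition grad_form2 ::
    "('n::finite cmat \<Rightarrow> 'n cmat) \<Rightarrow> 'n cmat \<Rightarrow> 'n cmat \<Rightarrow> 'n cmat"
  where "grad_form2 \<L> x y =
    (1 / 2) *\<^sub>R (grad_form \<L> x (\<L> y) + grad_form \<L> (\<L> x) y - \<L> (grad_form \<L> x y))"

definition A_map :: "('n::finite cmat \<Rightarrow> 'n cmat) \<Rightarrow> 'n cmat \<Rightarrow> 'n cmat"
  where "A_map \<L> x =
    (1 / 2) *\<^sub>R anticomm x (conv (mat 1) (bar (L0_hat \<L>) - L0_hat \<L>))"

end

theory Submission
  imports Defs
begin

text \<open>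
  The equivalence is an instance of Bakry's interpolation argument. Write
  \<open>\<kappa> = 1 / (\<Sum>j. (1 + \<mu>\<^sub>j)\<^sup>2) \<ge> 0\<close>, \<open>K = \<L>\<^sup>* + A\<close>, and for fixed \<open>t > 0\<close> and \<open>x\<close> let
  \<open>f s = e\<^bsup>-2\<beta>s\<^esup> \<Phi>\<^sub>s (\<Gamma>(\<Phi>\<^bsub>t-s\<^esub> x))\<close>. Then \<open>f t - f 0\<close> is
  the difference of the two sides of \<open>\<Gamma>(\<Phi>\<^sub>t x) \<le> e\<^bsup>-2\<beta>t\<^esup> \<Phi>\<^sub>t (\<Gamma>(x))\<close>, while
  \<open>f' s = 2 e\<^bsup>-2\<beta>s\<^esup> \<Phi>\<^sub>s (\<Gamma>\<^sub>2(u) - \<beta> \<Gamma>(u))\<close> with \<open>u = \<Phi>\<^bsub>t-s\<^esub> x\<close>; this is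
  \<open>has_vector_derivative_interpolation\<close>.

  From curvature to gradient estimate: the curvature bound and positivity of \<open>\<Phi>\<^sub>s\<close> give
  \<open>f' s \<ge> 2\<kappa> e\<^bsup>-2\<beta>s\<^esup> \<Phi>\<^sub>s |(\<L> + K) u|\<^sup>2\<close>, and the Kadison-Schwarz inequality
  (\<open>Kadison_Schwarz\<close>) moves \<open>\<Phi>\<^sub>s\<close> inside the square. Because \<open>\<Phi>\<^sub>s \<L> \<Phi>\<^bsub>t-s\<^esub> = \<L> \<Phi>\<^sub>t\<close>, the
  term inside is \<open>\<L> \<Phi>\<^sub>t x + \<Phi>\<^sub>s K \<Phi>\<^bsub>t-s\<^esub> x\<close>. As \<open>\<nu>\<^sub>t\<close> is a probability measure proportional to
  \<open>e\<^bsup>-2\<beta>s\<^esup> ds\<close>, integrating over \<open>[0, t]\<close> and applying Jensen's inequality for the operator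
  convex function \<open>|\<cdot>|\<^sup>2\<close> (\<open>operator_Jensen\<close>) yields the estimate, with the constant
  \<open>\<kappa> (1 - e\<^bsup>-2\<beta>t\<^esup>) / \<beta>\<close>.

  From gradient estimate to curvature: both sides agree at \<open>t = 0\<close>, so dividing by \<open>t\<close> and letting
  \<open>t\<close> tend to \<open>0\<close> preserves the inequality, the positive semidefinite cone being closed. The average
  against \<open>\<nu>\<^sub>t\<close> tends to \<open>K x\<close>, since \<open>\<nu>\<^sub>t\<close> concentrates at \<open>0\<close> and \<open>(s, r) \<mapsto> \<Phi>\<^sub>s K \<Phi>\<^sub>r x\<close> is jointly
  continuous, and the limit is twice the curvature inequality.

  The argument is carried out for a linear map \<open>K\<close> and a number \<open>\<kappa> \<ge> 0\<close> in \<open>gradient_estimate_iff\<close>.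
\<close>

section \<open>The positive semidefinite cone\<close>

lemma linear_cdot_left: "linear (\<lambda>a. cdot (a *v \<xi>) \<eta>)"
  by (rule linearI)
    (simp_all add: cdot_def matrix_vector_mult_add_rdistrib sum.distrib algebra_simps
      matrix_vector_mult_def scaleR_sum_right sum_distrib_left sum_distrib_right)

lemma cdot_add_left: "cdot (\<xi> + \<eta>) \<zeta> = cdot \<xi> \<zeta> + cdot \<eta> \<zeta>"
  and cdot_add_right: "cdot \<zeta> (\<xi> + \<eta>) = cdot \<zeta> \<xi> + cdot \<zeta> \<eta>"
  and cdot_minus_left: "cdot (- \<xi>) \<zeta> = - cdot \<xi> \<zeta>"
  and cdot_minus_right: "cdot \<zeta> (- \<xi>) = - cdot \<zeta> \<xi>"
  and cdot_scale_left: "cdot (c *s \<xi>) \<zeta> = c * cdot \<xi> \<zeta>"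
  and cdot_scale_right: "cdot \<zeta> (c *s \<xi>) = cnj c * cdot \<zeta> \<xi>"
  and cdot_commute: "cdot \<xi> \<zeta> = cnj (cdot \<zeta> \<xi>)"
  by (simp_all add: cdot_def algebra_simps sum.distrib sum_negf sum_distrib_left)

lemma cdot_self_nonneg: "cdot \<xi> \<xi> \<in> \<real>\<^sub>\<ge>\<^sub>0"
  unfolding cdot_def by (auto simp: complex_nonneg_Reals_iff intro!: sum_nonneg)

lemma cdot_cadj: "cdot (cadj a *v \<xi>) \<eta> = cdot \<xi> (a *v \<eta>)"
proof -
  have "cdot (cadj a *v \<xi>) \<eta> = (\<Sum>i\<in>UNIV. \<Sum>j\<in>UNIV. \<xi> $ j * cnj (a $ j $ i * \<eta> $ i))"
    by (simp add: cdot_def matrix_vector_mult_def cadj_def sum_distrib_right sum_distrib_left mult_ac)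
  also have "\<dots> = (\<Sum>j\<in>UNIV. \<Sum>i\<in>UNIV. \<xi> $ j * cnj (a $ j $ i * \<eta> $ i))"
    by (rule sum.swap)
  finally show ?thesis
    by (simp add: cdot_def matrix_vector_mult_def sum_distrib_left)
qed

lemma psd_iff: "psd a \<longleftrightarrow> (\<forall>\<xi>. 0 \<le> Re (cdot (a *v \<xi>) \<xi>) \<and> Im (cdot (a *v \<xi>) \<xi>) = 0)"
  by (simp add: psd_def complex_nonneg_Reals_iff)

lemma psd_add: "psd a \<Longrightarrow> psd b \<Longrightarrow> psd (a + b)"
  by (simp add: psd_iff linear_add[OF linear_cdot_left])

lemma psd_scaleR: "0 \<le> r \<Longrightarrow> psd a \<Longrightarrow> psd (r *\<^sub>R a)"
  by (simp add: psd_iff linear_scale[OF linear_cdot_left])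

lemma psd_abs_sq: "psd (abs_sq a)"
  unfolding psd_def abs_sq_def matrix_vector_mul_assoc[symmetric] cdot_cadj
  by (simp add: cdot_self_nonneg)

lemma psd_limit:
  assumes "(f \<longlongrightarrow> a) F" "F \<noteq> bot" "\<forall>\<^sub>F s in F. psd (f s)"
  shows "psd a"
proof -
  have "cdot (a *v \<xi>) \<xi> \<in> \<real>\<^sub>\<ge>\<^sub>0" for \<xi>
  proof (rule Lim_in_closed_set[OF closed_nonneg_Reals_complex _ assms(2)])
    show "((\<lambda>s. cdot (f s *v \<xi>) \<xi>) \<longlongrightarrow> cdot (a *v \<xi>) \<xi>) F"
      by (rule bounded_linear.tendsto[OF linear_conv_bounded_linear[THEN iffD1, OF linear_cdot_left] assms(1)])
  qed (use assms(3) in \<open>simp add: psd_def eventually_mono\<close>)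
  then show ?thesis by (simp add: psd_def)
qed

lemma psd_has_integral:
  fixes f :: "real \<Rightarrow> 'k::finite cmat"
  assumes "(f has_integral a) S" "\<And>s. s \<in> S \<Longrightarrow> psd (f s)"
  shows "psd a"
proof -
  have "0 \<le> Re (cdot (a *v \<xi>) \<xi>) \<and> Im (cdot (a *v \<xi>) \<xi>) = 0" for \<xi>
  proof -
    have q: "((\<lambda>s. cdot (f s *v \<xi>) \<xi>) has_integral cdot (a *v \<xi>) \<xi>) S"
      using has_integral_linear[OF assms(1) linear_conv_bounded_linear[THEN iffD1, OF linear_cdot_left]]
      by (simp add: o_def)
    have "((\<lambda>s. Re (cdot (f s *v \<xi>) \<xi>)) has_integral Re (cdot (a *v \<xi>) \<xi>)) S"
      using has_integral_linear[OF q bounded_linear_Re] by (simp add: o_def)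
    then have "0 \<le> Re (cdot (a *v \<xi>) \<xi>)"
      by (rule has_integral_nonneg) (use assms(2) in \<open>simp add: psd_iff\<close>)
    moreover have "((\<lambda>s. Im (cdot (f s *v \<xi>) \<xi>)) has_integral Im (cdot (a *v \<xi>) \<xi>)) S"
      using has_integral_linear[OF q bounded_linear_Im] by (simp add: o_def)
    then have "((\<lambda>s. 0) has_integral Im (cdot (a *v \<xi>) \<xi>)) S"
      by (rule has_integral_eq[rotated]) (use assms(2) in \<open>simp add: psd_iff\<close>)
    then have "Im (cdot (a *v \<xi>) \<xi>) = 0" by simp
    ultimately show ?thesis ..
  qed
  then show ?thesis by (simp add: psd_iff)
qed

lemma bounded_bilinear_mult: "bounded_bilinear ((**) :: 'k::finite cmat \<Rightarrow> _)"
  unfolding bilinear_conv_bounded_bilinear[symmetric] bilinear_def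
  by (auto intro!: linearI simp: matrix_matrix_mult_def vec_eq_iff algebra_simps sum.distrib
      scaleR_sum_right)

lemma linear_cadj: "linear cadj"
  by (rule linearI) (simp_all add: cadj_def vec_eq_iff)

lemmas bilinear_matrix_simps =
  bounded_bilinear.add_left[OF bounded_bilinear_mult] bounded_bilinear.add_right[OF bounded_bilinear_mult]
  bounded_bilinear.diff_left[OF bounded_bilinear_mult] bounded_bilinear.diff_right[OF bounded_bilinear_mult]
  bounded_bilinear.scaleR_left[OF bounded_bilinear_mult] bounded_bilinear.scaleR_right[OF bounded_bilinear_mult]
  linear_add[OF linear_cadj] linear_diff[OF linear_cadj] linear_scale[OF linear_cadj]

text \<open>
  Instead of integrating \<open>|b - c|\<^sup>2 \<ge> 0\<close>, which needs \<open>|b|\<^sup>2\<close> to be integrable, its consequence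
  \<open>|b|\<^sup>2 \<ge> c\<^sup>* b + b\<^sup>* c - |c|\<^sup>2\<close> is integrated: the right-hand side is affine in \<open>b\<close>, and its mean is \<open>|c|\<^sup>2\<close>
  when \<open>c\<close> is the mean of \<open>b\<close>. For the same reason the inequality is stated for an integrable majorant \<open>g\<close>.
\<close>

lemma operator_Jensen:
  fixes b :: "real \<Rightarrow> 'k::finite cmat"
  assumes k: "0 \<le> k" and w: "\<And>s. s \<in> S \<Longrightarrow> 0 \<le> w s"
    and w1: "(w has_integral 1) S" and b: "((\<lambda>s. w s *\<^sub>R b s) has_integral c) S"
    and g: "(g has_integral d) S"
    and le: "\<And>s. s \<in> S \<Longrightarrow> (k * w s) *\<^sub>R abs_sq (b s) \<preceq> g s"
  shows "k *\<^sub>R abs_sq c \<preceq> d"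
proof -
  let ?h = "\<lambda>x. k *\<^sub>R (cadj c ** x + cadj x ** c)"
  have h: "linear ?h"
    by (rule linearI) (simp_all add: bilinear_matrix_simps algebra_simps)
  have i1: "((\<lambda>s. w s *\<^sub>R ?h (b s)) has_integral ?h c) S"
    using has_integral_linear[OF b linear_conv_bounded_linear[THEN iffD1, OF h]]
    by (simp only: o_def linear_scale[OF h])
  have i2: "((\<lambda>s. w s *\<^sub>R (k *\<^sub>R abs_sq c)) has_integral k *\<^sub>R abs_sq c) S"
    using has_integral_linear[OF w1 bounded_linear_scaleR_left, of "k *\<^sub>R abs_sq c"]
    by (simp add: o_def)
  have "psd (d - ?h c + k *\<^sub>R abs_sq c)"
  proof (rule psd_has_integral[OF has_integral_add[OF has_integral_diff[OF g i1] i2]])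
    fix s assume s: "s \<in> S"
    have "g s - w s *\<^sub>R ?h (b s) + w s *\<^sub>R (k *\<^sub>R abs_sq c)
        = (g s - (k * w s) *\<^sub>R abs_sq (b s)) + (k * w s) *\<^sub>R abs_sq (b s - c)"
      by (simp add: abs_sq_def bilinear_matrix_simps algebra_simps)
    also have "psd \<dots>"
      using le[OF s] w[OF s] k by (intro psd_add psd_scaleR psd_abs_sq) (auto simp: loewner_le_def)
    finally show "psd (g s - w s *\<^sub>R ?h (b s) + w s *\<^sub>R (k *\<^sub>R abs_sq c))" .
  qed
  moreover have "d - ?h c + k *\<^sub>R abs_sq c = d - k *\<^sub>R abs_sq c"
    unfolding abs_sq_def scaleR_add_right by (simp only: diff_diff_eq[symmetric] diff_add_cancel)
  ultimately show ?thesis by (simp only: loewner_le_def)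
qed

section \<open>Completely positive maps\<close>

lemma clinear_map_iff:
  "clinear_map f \<longleftrightarrow> (\<forall>x y. f (x + y) = f x + f y) \<and> (\<forall>c x. f (cscale c x) = cscale c (f x))"
proof -
  have "vector_space (cscale :: complex \<Rightarrow> 'a cmat \<Rightarrow> _)"
    by unfold_locales (simp_all add: cscale_def vec_eq_iff algebra_simps)
  then show ?thesis
    by (simp add: clinear_map_def Vector_Spaces.linear_def module_hom_def module_hom_axioms_def
        module_pair_def vector_space_pair_def module_iff_vector_space)
qed

lemma cscale_of_real: "cscale (of_real r) a = r *\<^sub>R a"
  by (simp add: cscale_def vec_eq_iff scaleR_conv_of_real[where 'a = complex])

lemma clinear_map_imp_linear: "clinear_map f \<Longrightarrow> linear f"
  unfolding clinear_map_iff by (rule linearI) (auto simp flip: cscale_of_real)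

lemma completely_positive_imp_positive:
  assumes "completely_positive \<Phi>" "psd a"
  shows "psd (\<Phi> a)"
proof -
  have "block_psd 1 (\<lambda>i j. a)"
    using assms(2) by (simp add: block_psd_def psd_def)
  then have "block_psd 1 (\<lambda>i j. \<Phi> a)"
    using assms(1) unfolding completely_positive_def by blast
  then have "cdot (\<Phi> a *v \<xi>) \<xi> \<in> \<real>\<^sub>\<ge>\<^sub>0" for \<xi>
    unfolding block_psd_def by (drule_tac spec[of _ "\<lambda>_. \<xi>"]) simp
  then show ?thesis by (simp add: psd_def)
qed

text \<open>
  The \<open>2 \<times> 2\<close> block matrix with rows \<open>(a\<^sup>* a, a\<^sup>*)\<close> and \<open>(a, 1)\<close> has the quadratic form
  \<open>\<parallel>a \<xi> + \<eta>\<parallel>\<^sup>2\<close> and is therefore positive. Its image under a unital completely positive map has rows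
  \<open>(\<Phi>(a\<^sup>* a), \<Phi>(a\<^sup>*))\<close> and \<open>(\<Phi>(a), 1)\<close>; evaluating the form of this image at \<open>\<eta> = - \<Phi>(a) \<xi>\<close> is the claim.
\<close>

lemma Kadison_Schwarz:
  assumes cp: "completely_positive \<Phi>" and unital: "\<Phi> (mat 1) = mat 1"
  shows "abs_sq (\<Phi> a) \<preceq> \<Phi> (abs_sq a)"
proof -
  let ?m = "\<lambda>i j :: nat. if i = 0 then if j = 0 then abs_sq a else cadj a
      else if j = 0 then a else mat 1"
  have "block_psd 2 ?m"
    unfolding block_psd_def
  proof
    fix \<xi> :: "nat \<Rightarrow> complex ^ 'a"
    have "(\<Sum>i<2. \<Sum>j<2. cdot (?m i j *v \<xi> j) (\<xi> i)) = cdot (a *v \<xi> 0 + \<xi> 1) (a *v \<xi> 0 + \<xi> 1)"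
      by (simp add: numeral_2_eq_2 abs_sq_def matrix_vector_mul_assoc[symmetric] cdot_cadj
          cdot_add_left cdot_add_right)
    then show "(\<Sum>i<2. \<Sum>j<2. cdot (?m i j *v \<xi> j) (\<xi> i)) \<in> \<real>\<^sub>\<ge>\<^sub>0"
      by (simp only: cdot_self_nonneg)
  qed
  then have "block_psd 2 (\<lambda>i j. \<Phi> (?m i j))"
    using cp unfolding completely_positive_def by blast
  then have *: "cdot (\<Phi> (abs_sq a) *v \<xi>) \<xi> + cdot (\<Phi> (cadj a) *v \<eta>) \<xi>
      + (cdot (\<Phi> a *v \<xi>) \<eta> + cdot \<eta> \<eta>) \<in> \<real>\<^sub>\<ge>\<^sub>0" for \<xi> \<eta>
    unfolding block_psd_def
    by (drule_tac spec[of _ "\<lambda>i. if i = 0 then \<xi> else \<eta>"]) (simp add: numeral_2_eq_2 unital)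
  \<comment> \<open>The form is real for all vectors; replacing \<open>\<eta>\<close> by \<open>\<i> \<eta>\<close> separates real and imaginary parts,
    which shows \<open>\<Phi> (a\<^sup>*) = (\<Phi> a)\<^sup>*\<close>.\<close>
  have sym: "cdot (\<Phi> (cadj a) *v \<eta>) \<xi> = cnj (cdot (\<Phi> a *v \<xi>) \<eta>)" for \<xi> \<eta>
  proof -
    have im: "Im (cdot (\<Phi> (cadj a) *v \<eta>) \<xi>) + Im (cdot (\<Phi> a *v \<xi>) \<eta>) = 0" for \<eta>
      using *[of \<xi> \<eta>] *[of \<xi> 0] cdot_self_nonneg[of \<eta>]
      by (simp add: complex_nonneg_Reals_iff cdot_def)
    from im[of \<eta>] im[of "\<i> *s \<eta>"] show ?thesis
      by (simp add: complex_eq_iff vector_scalar_commute cdot_scale_left cdot_scale_right)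
  qed
  have "cdot ((\<Phi> (abs_sq a) - abs_sq (\<Phi> a)) *v \<xi>) \<xi> \<in> \<real>\<^sub>\<ge>\<^sub>0" for \<xi>
    using *[of \<xi> "- (\<Phi> a *v \<xi>)"] cdot_commute[of "\<Phi> a *v \<xi>" "\<Phi> a *v \<xi>"]
    by (simp add: sym cdot_minus_left cdot_minus_right
        linear_diff[OF linear_cdot_left] abs_sq_def cdot_cadj flip: matrix_vector_mul_assoc)
  then show ?thesis by (simp add: loewner_le_def psd_def)
qed

section \<open>The semigroup as a power series\<close>

text \<open>
  \<open>flow L t\<close> is \<open>e\<^bsup>-tL\<^esup>\<close> for every real \<open>t\<close>. Working on the whole line gives two-sided derivatives,
  also at the end points \<open>s = 0\<close> and \<open>s = t\<close> of the interpolation.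
\<close>

definition flow :: "('n::finite cmat \<Rightarrow> 'n cmat) \<Rightarrow> real \<Rightarrow> 'n cmat \<Rightarrow> 'n cmat"
  where "flow L t = exp_map (\<lambda>x. - (t *\<^sub>R L x))"

definition flow_coeff :: "('n::finite cmat \<Rightarrow> 'n cmat) \<Rightarrow> nat \<Rightarrow> 'n cmat \<Rightarrow> 'n cmat"
  where "flow_coeff L k x = ((- 1) ^ k / fact k) *\<^sub>R (L ^^ k) x"

lemma linear_funpow: "linear (L :: 'a::real_vector \<Rightarrow> 'a) \<Longrightarrow> linear (L ^^ k)"
  by (induction k) (auto intro: linear_compose linear_id simp: id_def[symmetric])

lemma linear_flow_coeff: "linear L \<Longrightarrow> linear (flow_coeff L k)"
  unfolding flow_coeff_def by (intro linear_compose_scale_right linear_funpow)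

lemma flow_coeff_Suc:
  "real (Suc k) *\<^sub>R flow_coeff L (Suc k) x = - flow_coeff L k (L x)"
  by (simp add: flow_coeff_def funpow_Suc_right del: funpow.simps of_nat_Suc)

lemma flow_coeff_commute:
  assumes "linear L" shows "flow_coeff L k (L x) = L (flow_coeff L k x)"
  by (simp add: flow_coeff_def linear_scale[OF assms] funpow_swap1)

lemma summable_flow:
  assumes L: "linear L" shows "summable (\<lambda>k. t ^ k *\<^sub>R flow_coeff L k x)"
proof -
  obtain K where K: "\<And>x. norm (L x) \<le> K * norm x" "0 < K"
    using L linear_bounded_pos by blast
  have pow: "norm ((L ^^ k) x) \<le> K ^ k * norm x" for k
  proof (induction k)
    case (Suc k)
    have "norm ((L ^^ Suc k) x) \<le> K * norm ((L ^^ k) x)" using K(1) by simp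
    also have "\<dots> \<le> K * (K ^ k * norm x)" using Suc K(2) by simp
    finally show ?case by (simp add: mult_ac)
  qed simp
  have "summable (\<lambda>k. inverse (fact k) * (\<bar>t\<bar> * K) ^ k * norm x)"
    by (intro summable_mult2 summable_exp)
  moreover have "norm (t ^ k *\<^sub>R flow_coeff L k x) \<le> inverse (fact k) * (\<bar>t\<bar> * K) ^ k * norm x" for k
  proof -
    have "norm (t ^ k *\<^sub>R flow_coeff L k x) = \<bar>t\<bar> ^ k / fact k * norm ((L ^^ k) x)"
      unfolding flow_coeff_def norm_scaleR by (simp add: abs_mult power_abs)
    also have "\<dots> \<le> \<bar>t\<bar> ^ k / fact k * (K ^ k * norm x)"
      by (rule mult_left_mono[OF pow]) simp
    also have "\<dots> = inverse (fact k) * (\<bar>t\<bar> * K) ^ k * norm x"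
      unfolding power_mult_distrib divide_inverse by (simp only: mult_ac)
    finally show ?thesis .
  qed
  ultimately show ?thesis by (rule summable_comparison_test'[where N = 0])
qed

lemma flow_eq_suminf:
  assumes L: "linear L" shows "flow L t x = (\<Sum>k. t ^ k *\<^sub>R flow_coeff L k x)"
proof -
  have "((\<lambda>x. - (t *\<^sub>R L x)) ^^ k) x = (- t) ^ k *\<^sub>R (L ^^ k) x" for k
    by (induction k) (simp_all add: linear_scale[OF L])
  moreover have "(1 / fact k) *\<^sub>R (- t) ^ k *\<^sub>R y = t ^ k *\<^sub>R ((- 1) ^ k / fact k) *\<^sub>R y" for k and y :: "'a cmat"
    by (simp add: power_minus[of t] mult_ac)
  ultimately show ?thesis by (simp only: flow_def exp_map_def flow_coeff_def)
qed

lemma linear_flow: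
  assumes L: "linear L" shows "linear (flow L t)"
proof (rule linearI)
  show "flow L t (x + y) = flow L t x + flow L t y" for x y
    by (simp add: flow_eq_suminf[OF L] linear_add[OF linear_flow_coeff[OF L]] scaleR_add_right
        suminf_add[OF summable_flow[OF L] summable_flow[OF L]])
  show "flow L t (r *\<^sub>R x) = r *\<^sub>R flow L t x" for r x
    by (simp only: flow_eq_suminf[OF L] linear_scale[OF linear_flow_coeff[OF L]]
        scaleR_left_commute[of _ r] suminf_scaleR_right[OF summable_flow[OF L]])
qed

lemma flow_commute:
  assumes L: "linear L" shows "flow L t (L x) = L (flow L t x)"
  using bounded_linear.suminf[OF linear_conv_bounded_linear[THEN iffD1, OF L] summable_flow[OF L], of t x]
  by (simp add: flow_eq_suminf L flow_coeff_commute linear_scale)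

lemma flow_0: "linear L \<Longrightarrow> flow L 0 x = x"
proof -
  assume L: "linear L"
  have "(\<lambda>k. 0 ^ k *\<^sub>R flow_coeff L k x) sums (0 ^ 0 *\<^sub>R flow_coeff L 0 x)"
    using sums_finite[of "{0::nat}" "\<lambda>k. 0 ^ k *\<^sub>R flow_coeff L k x"] by simp
  then show ?thesis by (simp add: flow_eq_suminf[OF L] sums_iff flow_coeff_def)
qed

text \<open>
  Each real coordinate of \<open>flow L t x\<close> is an everywhere convergent scalar power series in \<open>t\<close>, so it can
  be differentiated term by term.
\<close>

lemma flow_has_vector_derivative:
  assumes L: "linear L"
  shows "((\<lambda>t. flow L t x) has_vector_derivative - flow L t (L x)) (at t)"
  unfolding has_vector_derivative_def
proof (subst has_derivative_componentwise_within, rule ballI)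
  fix b :: "'a cmat" assume "b \<in> Basis"
  have inner: "flow L t y \<bullet> b = (\<Sum>k. (flow_coeff L k y \<bullet> b) * t ^ k)"
    "summable (\<lambda>k. (flow_coeff L k y \<bullet> b) * t ^ k)" for t y
    using bounded_linear.suminf[OF bounded_linear_inner_left[of b] summable_flow[OF L], of t y]
      bounded_linear.summable[OF bounded_linear_inner_left[of b] summable_flow[OF L], of t y]
    by (simp_all add: flow_eq_suminf[OF L] mult.commute)
  have coeff: "diffs (\<lambda>k. flow_coeff L k x \<bullet> b) k * t ^ k
      = - ((flow_coeff L k (L x) \<bullet> b) * t ^ k)" for k
    using flow_coeff_Suc[of k L x, THEN arg_cong, of "\<lambda>y. y \<bullet> b"]
    by (simp add: diffs_def del: of_nat_Suc)
  have "((\<lambda>t. flow L t x \<bullet> b) has_field_derivative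
      (\<Sum>k. diffs (\<lambda>k. flow_coeff L k x \<bullet> b) k * t ^ k)) (at t)"
    unfolding inner(1) by (rule termdiffs_strong_converges_everywhere) (rule inner(2))
  moreover have "(\<Sum>k. diffs (\<lambda>k. flow_coeff L k x \<bullet> b) k * t ^ k) = - flow L t (L x) \<bullet> b"
    unfolding coeff suminf_minus[OF inner(2)] inner_minus_left inner(1) ..
  ultimately have "((\<lambda>t. flow L t x \<bullet> b) has_derivative (*) (- flow L t (L x) \<bullet> b)) (at t)"
    by (simp only: has_field_derivative_def)
  moreover have "(*) (- flow L t (L x) \<bullet> b) = (\<lambda>h. (h *\<^sub>R - flow L t (L x)) \<bullet> b)"
    by (simp add: fun_eq_iff)
  ultimately show "((\<lambda>t. flow L t x \<bullet> b) has_derivative (\<lambda>h. (h *\<^sub>R - flow L t (L x)) \<bullet> b)) (at t)"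
    by (simp only:)
qed

lemma flow_basis:
  assumes L: "linear L" shows "flow L t y = (\<Sum>b\<in>Basis. (y \<bullet> b) *\<^sub>R flow L t b)"
  using linear_sum[OF linear_flow[OF L], of t "\<lambda>b. (y \<bullet> b) *\<^sub>R b" Basis]
  by (simp add: euclidean_representation linear_scale[OF linear_flow[OF L]])

text \<open>
  The product rule for \<open>e\<^bsup>-sL\<^esup> y(s)\<close>. Expanding \<open>y\<close> in the basis reduces it to products of
  a scalar function and the curves \<open>s \<mapsto> e\<^bsup>-sL\<^esup> b\<close>; the same expansion gives joint continuity below.
\<close>

lemma flow_apply_has_vector_derivative:
  assumes L: "linear L" and y: "(y has_vector_derivative y') (at s)"
  shows "((\<lambda>s. flow L s (y s)) has_vector_derivative flow L s (y' - L (y s))) (at s)"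
proof -
  have "((\<lambda>s. y s \<bullet> b) has_real_derivative y' \<bullet> b) (at s)" for b
    unfolding has_real_derivative_iff_has_vector_derivative
    by (rule bounded_linear.has_vector_derivative[OF bounded_linear_inner_left y])
  then have "((\<lambda>s. \<Sum>b\<in>Basis. (y s \<bullet> b) *\<^sub>R flow L s b) has_vector_derivative
      (\<Sum>b\<in>Basis. (y s \<bullet> b) *\<^sub>R (- flow L s (L b)) + (y' \<bullet> b) *\<^sub>R flow L s b)) (at s)"
    by (intro has_vector_derivative_sum has_vector_derivative_scaleR flow_has_vector_derivative L)
  moreover have "(\<Sum>b\<in>Basis. (y s \<bullet> b) *\<^sub>R (- flow L s (L b)) + (y' \<bullet> b) *\<^sub>R flow L s b)
      = flow L s (y' - L (y s))"
  proof -
    have "(\<Sum>b\<in>Basis. (y s \<bullet> b) *\<^sub>R (- flow L s (L b)) + (y' \<bullet> b) *\<^sub>R flow L s b)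
        = (\<Sum>b\<in>Basis. (y' \<bullet> b) *\<^sub>R flow L s b) - L (\<Sum>b\<in>Basis. (y s \<bullet> b) *\<^sub>R flow L s b)"
      by (simp add: sum.distrib sum_negf sum_subtractf linear_sum[OF L] linear_scale[OF L] flow_commute[OF L])
    also have "\<dots> = flow L s y' - L (flow L s (y s))"
      by (simp only: flow_basis[OF L, symmetric])
    finally show ?thesis
      by (simp only: linear_diff[OF linear_flow[OF L]] flow_commute[OF L])
  qed
  moreover have "(\<lambda>s. flow L s (y s)) = (\<lambda>s. \<Sum>b\<in>Basis. (y s \<bullet> b) *\<^sub>R flow L s b)"
    by (rule ext, rule flow_basis[OF L])
  ultimately show ?thesis by simp
qed

lemma continuous_flow_apply:
  fixes f :: "'a::topological_space \<Rightarrow> real" and g :: "'a \<Rightarrow> 'n::finite cmat"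
  assumes L: "linear L" and "continuous_on S f" "continuous_on S g"
  shows "continuous_on S (\<lambda>p. flow L (f p) (g p))"
proof -
  have "continuous_on UNIV (\<lambda>t. flow L t b)" for b
    by (auto simp: continuous_on_eq_continuous_at intro!: has_vector_derivative_continuous
        flow_has_vector_derivative[OF L])
  then have "continuous_on S (\<lambda>p. flow L (f p) b)" for b
    by (rule continuous_on_compose2[OF _ assms(2)]) simp
  then have "continuous_on S (\<lambda>p. \<Sum>b\<in>Basis. (g p \<bullet> b) *\<^sub>R flow L (f p) b)"
    by (intro continuous_intros assms)
  then show ?thesis by (simp only: flow_basis[OF L, symmetric])
qed

lemma quantum_Markov_semigroup_linear: "quantum_Markov_semigroup \<Phi> \<L> \<Longrightarrow> linear \<L>"
  by (simp add: quantum_Markov_semigroup_def clinear_map_imp_linear)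

lemma quantum_Markov_semigroup_flow:
  "quantum_Markov_semigroup \<Phi> \<L> \<Longrightarrow> 0 \<le> t \<Longrightarrow> \<Phi> t = flow \<L> t"
  by (simp add: quantum_Markov_semigroup_def flow_def)

section \<open>Linearity of the adjoint, of \<open>A\<close> and of the gradient form\<close>

lemma inner_cmat_eq: "(x :: 'n::finite cmat) \<bullet> y = Re (trace (cadj y ** x))"
proof -
  have "x \<bullet> y = (\<Sum>i\<in>UNIV. \<Sum>j\<in>UNIV. Re (cnj (y $ i $ j) * x $ i $ j))"
    by (simp add: inner_vec_def inner_complex_def mult_ac)
  also have "\<dots> = (\<Sum>j\<in>UNIV. \<Sum>i\<in>UNIV. Re (cnj (y $ i $ j) * x $ i $ j))"
    by (rule sum.swap)
  finally show ?thesis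
    by (simp add: trace_def matrix_matrix_mult_def cadj_def)
qed

lemma trace_cscale_i: "trace (cadj y ** cscale \<i> x) = \<i> * trace (cadj y ** x)"
  by (simp add: trace_def matrix_matrix_mult_def cscale_def sum_distrib_left mult_ac)

text \<open>
  The Euclidean inner product on matrices is the real part of the trace form, so the real adjoint has the
  correct real parts; complex linearity of \<open>L\<close>, applied to \<open>\<i> x\<close>, supplies the imaginary parts.
\<close>

lemma L2_adjoint_eq_adjoint:
  assumes L: "clinear_map L"
  shows "L2_adjoint L = adjoint L"
proof -
  have lin: "linear L" by (rule clinear_map_imp_linear[OF L])
  have tr: "trace (cadj y ** L x) = trace (cadj (adjoint L y) ** x)" for x y
  proof -
    have re: "Re (trace (cadj y ** L x)) = Re (trace (cadj (adjoint L y) ** x))" for x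
      using adjoint_works[OF lin, of x y] by (simp add: inner_cmat_eq inner_commute)
    have "L (cscale \<i> x) = cscale \<i> (L x)" using L by (simp add: clinear_map_iff)
    with re[of x] re[of "cscale \<i> x"] show ?thesis
      by (simp add: complex_eq_iff trace_cscale_i)
  qed
  show ?thesis
    unfolding L2_adjoint_def
  proof (rule the_equality)
    show "\<forall>x y. ntr (cadj y ** L x) = ntr (cadj (adjoint L y) ** x)"
      by (simp add: ntr_def tr)
  next
    fix L' assume "\<forall>x y. ntr (cadj y ** L x) = ntr (cadj (L' y) ** x)"
    then have "L x \<bullet> y = x \<bullet> L' y" for x y
      by (simp add: ntr_def inner_cmat_eq)
    then show "L' = adjoint L" by (intro adjoint_unique[symmetric]) simp
  qed
qed

lemma linear_L2_adjoint: "clinear_map L \<Longrightarrow> linear (L2_adjoint L)"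
  by (simp add: L2_adjoint_eq_adjoint adjoint_linear clinear_map_imp_linear)

lemma linear_A_map: "linear (A_map L)"
  unfolding A_map_def anticomm_def
  by (rule linearI) (simp_all add: bilinear_matrix_simps algebra_simps)

lemma bounded_bilinear_grad_form:
  assumes "linear L" shows "bounded_bilinear (grad_form L)"
  unfolding bilinear_conv_bounded_bilinear[symmetric] bilinear_def grad_form_def
  by (auto intro!: linearI simp: bilinear_matrix_simps algebra_simps linear_add[OF assms] linear_scale[OF assms])

section \<open>Interpolation along the semigroup\<close>

lemma has_vector_derivative_imp_quotient_tendsto:
  fixes f :: "real \<Rightarrow> 'a::real_normed_vector"
  assumes "(f has_vector_derivative f') (at 0)" "f 0 = 0"
  shows "((\<lambda>t. (1 / t) *\<^sub>R f t) \<longlongrightarrow> f') (at_right 0)"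
proof -
  have "((\<lambda>t. (1 / norm (t - 0)) *\<^sub>R (f t - (f 0 + (t - 0) *\<^sub>R f'))) \<longlongrightarrow> 0) (at_right 0)"
    using has_vector_derivative_at_within[OF assms(1)]
    by (simp add: has_vector_derivative_def has_derivative_within divide_inverse)
  moreover have "\<forall>\<^sub>F t in at_right 0. (1 / norm (t - 0)) *\<^sub>R (f t - (f 0 + (t - 0) *\<^sub>R f')) = (1 / t) *\<^sub>R f t - f'"
    using eventually_at_right_less[of "0 :: real"]
    by eventually_elim (simp add: assms(2) scaleR_diff_right)
  ultimately have "((\<lambda>t. (1 / t) *\<^sub>R f t - f') \<longlongrightarrow> 0) (at_right 0)"
    by (rule Lim_transform_eventually)
  then show ?thesis
    by (rule LIM_zero_cancel)
qed

text \<open>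
  With \<open>u s = e\<^bsup>-(t-s)L\<^esup> x\<close> one has \<open>u' = L u\<close>. Differentiating \<open>\<Gamma>(u, u)\<close> gives the first two
  terms of \<open>2 \<Gamma>\<^sub>2(u, u)\<close>, the outer semigroup contributes the third, \<open>- L \<Gamma>(u, u)\<close>, and the
  exponential factor contributes \<open>- 2 \<beta> \<Gamma>(u, u)\<close>.
\<close>

lemma has_vector_derivative_interpolation:
  assumes L: "linear L"
  shows "((\<lambda>s. flow L s (exp (- 2 * \<beta> * s) *\<^sub>R
            grad_form L (flow L (t - s) x) (flow L (t - s) x)))
    has_vector_derivative
      (2 * exp (- 2 * \<beta> * s)) *\<^sub>R flow L s
        (grad_form2 L (flow L (t - s) x) (flow L (t - s) x)
          - \<beta> *\<^sub>R grad_form L (flow L (t - s) x) (flow L (t - s) x))) (at s)"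
proof -
  let ?u = "\<lambda>s. flow L (t - s) x" and ?G = "grad_form L"
  let ?e = "exp (- 2 * \<beta> * s)"
  have "((\<lambda>s. t - s) has_vector_derivative - 1) (at s)"
    by (auto intro!: derivative_eq_intros)
  from vector_diff_chain_at[OF this flow_has_vector_derivative[OF L]]
  have u: "(?u has_vector_derivative L (?u s)) (at s)"
    by (simp add: o_def flow_commute[OF L])
  have e: "((\<lambda>s. exp (- 2 * \<beta> * s)) has_real_derivative - 2 * \<beta> * ?e) (at s)"
    by (auto intro!: derivative_eq_intros)
  have "((\<lambda>s. exp (- 2 * \<beta> * s) *\<^sub>R ?G (?u s) (?u s)) has_vector_derivative
      ?e *\<^sub>R (?G (?u s) (L (?u s)) + ?G (L (?u s)) (?u s)) + (- 2 * \<beta> * ?e) *\<^sub>R ?G (?u s) (?u s)) (at s)"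
    by (intro has_vector_derivative_scaleR e
        bounded_bilinear.has_vector_derivative[OF bounded_bilinear_grad_form[OF L]] u)
  note flow_apply_has_vector_derivative[OF L this]
  moreover have "flow L s (?e *\<^sub>R (?G (?u s) (L (?u s)) + ?G (L (?u s)) (?u s))
      + (- 2 * \<beta> * ?e) *\<^sub>R ?G (?u s) (?u s) - L (?e *\<^sub>R ?G (?u s) (?u s)))
    = (2 * ?e) *\<^sub>R flow L s (grad_form2 L (?u s) (?u s) - \<beta> *\<^sub>R ?G (?u s) (?u s))"
    unfolding linear_scale[OF linear_flow[OF L], symmetric]
    by (simp add: grad_form2_def linear_scale[OF L] scaleR_diff_right scaleR_add_right mult_ac)
      (simp only: diff_diff_eq add_ac)
  ultimately show ?thesis by simp
qed

lemma exp_weight_has_integral: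
  fixes \<beta> t :: real
  assumes "\<beta> \<noteq> 0" "0 < t"
  shows "((\<lambda>s. 2 * \<beta> * exp (- 2 * \<beta> * s) / (1 - exp (- 2 * \<beta> * t))) has_integral 1) {0..t}"
proof -
  let ?d = "1 - exp (- 2 * \<beta> * t)"
  have "?d \<noteq> 0" using assms by simp
  have "((\<lambda>s. - exp (- 2 * \<beta> * s) / ?d) has_real_derivative
      2 * \<beta> * exp (- 2 * \<beta> * s) / ?d) (at s within {0..t})" for s
    using \<open>?d \<noteq> 0\<close> by (auto intro!: derivative_eq_intros)
  then have "((\<lambda>s. 2 * \<beta> * exp (- 2 * \<beta> * s) / ?d) has_integral
      - exp (- 2 * \<beta> * t) / ?d - - exp (- 2 * \<beta> * 0) / ?d) {0..t}"
    using assms by (intro fundamental_theorem_of_calculus)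
      (auto simp flip: has_real_derivative_iff_has_vector_derivative)
  then show ?thesis using \<open>?d \<noteq> 0\<close> by (simp add: diff_divide_distrib[symmetric])
qed

lemma exp_weight_ratio_nonneg:
  fixes \<beta> t :: real
  assumes "0 \<le> t" shows "0 \<le> (1 - exp (- 2 * \<beta> * t)) / \<beta>"
  using assms by (cases "0 \<le> \<beta>") (auto simp: zero_le_divide_iff mult_nonneg_nonneg mult_nonpos_nonneg)

text \<open>
  Numerator and denominator both have the sign of \<open>\<beta>\<close>, so \<open>\<nu>\<^sub>t\<close> is a positive measure also for
  negative \<open>\<beta>\<close>.
\<close>

lemma exp_weight_nonneg:
  fixes \<beta> t s :: real
  assumes "0 \<le> t" shows "0 \<le> 2 * \<beta> * exp (- 2 * \<beta> * s) / (1 - exp (- 2 * \<beta> * t))"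
  using assms by (cases "0 \<le> \<beta>") (auto simp: zero_le_divide_iff mult_nonneg_nonneg mult_nonpos_nonneg mult_le_0_iff)

section \<open>Gradient estimate and curvature bound\<close>

text \<open>
  Interpolation proves the estimate from the curvature bound; differentiating the estimate at \<open>t = 0\<close>
  recovers the bound.
\<close>

proposition gradient_estimate_iff:
  fixes \<Phi> :: "real \<Rightarrow> 'n::finite cmat \<Rightarrow> 'n cmat"
  assumes qms: "quantum_Markov_semigroup \<Phi> \<L>"
    and K: "linear K" and \<beta>: "\<beta> \<noteq> 0" and \<kappa>: "0 \<le> \<kappa>"
  shows
    "(\<forall>x. \<forall>t>0.
        grad_form \<L> (\<Phi> t x) (\<Phi> t x) \<preceq>
          exp (- 2 * \<beta> * t) *\<^sub>R \<Phi> t (grad_form \<L> x x)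
          - ((1 - exp (- 2 * \<beta> * t)) / \<beta> * \<kappa>) *\<^sub>R
              abs_sq (\<L> (\<Phi> t x) +
                integral {0..t} (\<lambda>s.
                  (2 * \<beta> * exp (- 2 * \<beta> * s) / (1 - exp (- 2 * \<beta> * t))) *\<^sub>R
                    \<Phi> s (K (\<Phi> (t - s) x)))))
     \<longleftrightarrow>
     (\<forall>x. \<beta> *\<^sub>R grad_form \<L> x x + \<kappa> *\<^sub>R abs_sq (\<L> x + K x) \<preceq> grad_form2 \<L> x x)"
    (is "?est \<longleftrightarrow> ?curv")
proof -
  have L: "linear \<L>" by (rule quantum_Markov_semigroup_linear[OF qms])
  note flow = quantum_Markov_semigroup_flow[OF qms]
  have cp: "completely_positive (flow \<L> s)" and unital: "flow \<L> s (mat 1) = mat 1" if "0 \<le> s" for s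
    using qms that flow[OF that] unfolding quantum_Markov_semigroup_def by metis+
  have semigroup: "flow \<L> s (flow \<L> (t - s) x) = flow \<L> t x" if "0 \<le> s" "s \<le> t" for s t x
  proof -
    have "\<Phi> (s + (t - s)) = \<Phi> s \<circ> \<Phi> (t - s)"
      using qms that unfolding quantum_Markov_semigroup_def by (meson diff_ge_0_iff_ge)
    then show ?thesis using that by (simp add: flow fun_eq_iff)
  qed
  let ?w = "\<lambda>t s. 2 * \<beta> * exp (- 2 * \<beta> * s) / (1 - exp (- 2 * \<beta> * t))"
  let ?avg = "\<lambda>t x. integral {0..t} (\<lambda>s. ?w t s *\<^sub>R flow \<L> s (K (flow \<L> (t - s) x)))"
  let ?c = "\<lambda>t. (1 - exp (- 2 * \<beta> * t)) / \<beta> * \<kappa>"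
  let ?G = "\<lambda>x. grad_form \<L> x x"
  let ?gap = "\<lambda>t x. exp (- 2 * \<beta> * t) *\<^sub>R flow \<L> t (?G x) - ?G (flow \<L> t x)"
  have avg_flow: "integral {0..t} (\<lambda>s. ?w t s *\<^sub>R \<Phi> s (K (\<Phi> (t - s) x))) = ?avg t x" for t x
    by (rule integral_cong) (simp add: flow)
  have est: "?est \<longleftrightarrow> (\<forall>x. \<forall>t>0. psd (?gap t x - ?c t *\<^sub>R abs_sq (\<L> (flow \<L> t x) + ?avg t x)))"
  proof -
    have "psd (e - c - a) \<longleftrightarrow> psd (e - a - c)" for e c a :: "'n cmat"
      by (simp only: diff_diff_eq add.commute)
    then show ?thesis
      unfolding loewner_le_def avg_flow by (simp add: flow)
  qed
  have cont_K: "continuous_on S K" for S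
    by (rule linear_continuous_on) (use K in \<open>simp add: linear_conv_bounded_linear\<close>)
  have cont: "continuous_on UNIV (\<lambda>p. flow \<L> (fst p) (K (flow \<L> (snd p) x)))" for x
    by (intro continuous_flow_apply L continuous_on_compose2[OF cont_K[of UNIV]] continuous_intros) auto
  have int_avg: "((\<lambda>s. ?w t s *\<^sub>R flow \<L> s (K (flow \<L> (t - s) x))) has_integral ?avg t x) {0..t}"
    if "0 < t" for t x
  proof (rule integrable_integral, rule integrable_continuous_interval)
    have "1 - exp (- 2 * \<beta> * t) \<noteq> 0" using that \<beta> by simp
    then show "continuous_on {0..t} (\<lambda>s. ?w t s *\<^sub>R flow \<L> s (K (flow \<L> (t - s) x)))"
      by (intro continuous_intros continuous_flow_apply L continuous_on_compose2[OF cont_K[of UNIV]]) auto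
  qed
  have "?est" if curv: "?curv"
    unfolding est
  proof (intro allI impI)
    fix x and t :: real assume t: "0 < t"
    let ?u = "\<lambda>s. flow \<L> (t - s) x"
    let ?b = "\<lambda>s. \<L> (flow \<L> t x) + flow \<L> s (K (?u s))"
    let ?g = "\<lambda>s. (2 * exp (- 2 * \<beta> * s)) *\<^sub>R flow \<L> s (grad_form2 \<L> (?u s) (?u s) - \<beta> *\<^sub>R ?G (?u s))"
    have g: "(?g has_integral ?gap t x) {0..t}"
      using fundamental_theorem_of_calculus[OF less_imp_le[OF t]
          has_vector_derivative_at_within[OF has_vector_derivative_interpolation[OF L, of \<beta> t x]]]
      by (simp add: flow_0[OF L] linear_scale[OF linear_flow[OF L]])
    have b: "((\<lambda>s. ?w t s *\<^sub>R ?b s) has_integral \<L> (flow \<L> t x) + ?avg t x) {0..t}"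
      using has_integral_add[OF has_integral_linear[OF exp_weight_has_integral[OF \<beta> t] bounded_linear_scaleR_left]
          int_avg[OF t, of x], of "\<L> (flow \<L> t x)"]
      by (simp add: o_def scaleR_add_right)
    have le: "(?c t * ?w t s) *\<^sub>R abs_sq (?b s) \<preceq> ?g s" if s: "s \<in> {0..t}" for s
    proof -
      let ?y = "\<L> (?u s) + K (?u s)"
      have "1 - exp (- 2 * \<beta> * t) \<noteq> 0" using t \<beta> by simp
      then have coeff: "?c t * ?w t s = 2 * exp (- 2 * \<beta> * s) * \<kappa>"
        using \<beta> by (simp add: field_simps)
      \<comment> \<open>This rests on \<open>\<Phi>\<^sub>s \<L> \<Phi>\<^bsub>t-s\<^esub> = \<L> \<Phi>\<^sub>t\<close>.\<close>
      have b_eq: "?b s = flow \<L> s ?y"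
        using semigroup[of s t x] s
        by (simp add: linear_add[OF linear_flow[OF L]] flow_commute[OF L])
      have "psd (flow \<L> s (grad_form2 \<L> (?u s) (?u s) - \<beta> *\<^sub>R ?G (?u s) - \<kappa> *\<^sub>R abs_sq ?y))"
        using curv s by (intro completely_positive_imp_positive[OF cp])
          (auto simp: loewner_le_def diff_diff_eq)
      moreover have "psd (\<kappa> *\<^sub>R (flow \<L> s (abs_sq ?y) - abs_sq (flow \<L> s ?y)))"
        using Kadison_Schwarz[OF cp unital, of s ?y] s \<kappa> by (simp add: loewner_le_def psd_scaleR)
      ultimately have "psd ((2 * exp (- 2 * \<beta> * s)) *\<^sub>R
          (flow \<L> s (grad_form2 \<L> (?u s) (?u s) - \<beta> *\<^sub>R ?G (?u s) - \<kappa> *\<^sub>R abs_sq ?y)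
          + \<kappa> *\<^sub>R (flow \<L> s (abs_sq ?y) - abs_sq (flow \<L> s ?y))))"
        by (intro psd_scaleR[of "2 * exp _"] psd_add) auto
      also have "(2 * exp (- 2 * \<beta> * s)) *\<^sub>R
          (flow \<L> s (grad_form2 \<L> (?u s) (?u s) - \<beta> *\<^sub>R ?G (?u s) - \<kappa> *\<^sub>R abs_sq ?y)
          + \<kappa> *\<^sub>R (flow \<L> s (abs_sq ?y) - abs_sq (flow \<L> s ?y)))
          = ?g s - (?c t * ?w t s) *\<^sub>R abs_sq (?b s)"
      proof -
        have "p - q - \<kappa> *\<^sub>R y + \<kappa> *\<^sub>R (y - z) = p - q - \<kappa> *\<^sub>R z" for p q y z :: "'n cmat"
          by (simp only: scaleR_diff_right add_diff_eq diff_add_cancel)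
        then show ?thesis
          unfolding coeff b_eq linear_diff[OF linear_flow[OF L]] linear_scale[OF linear_flow[OF L]]
          by (simp only: scaleR_diff_right[of "2 * exp _"] scaleR_scaleR)
      qed
      finally show ?thesis by (simp add: loewner_le_def)
    qed
    have c: "0 \<le> ?c t"
      by (intro mult_nonneg_nonneg exp_weight_ratio_nonneg \<kappa>) (use t in simp)
    have "?c t *\<^sub>R abs_sq (\<L> (flow \<L> t x) + ?avg t x) \<preceq> ?gap t x"
      by (rule operator_Jensen[OF c exp_weight_nonneg[OF less_imp_le[OF t]]
            exp_weight_has_integral[OF \<beta> t] b g le])
    then show "psd (?gap t x - ?c t *\<^sub>R abs_sq (\<L> (flow \<L> t x) + ?avg t x))"
      by (simp add: loewner_le_def)
  qed
  moreover have "?curv" if "?est"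
  proof
    fix x
    let ?F = "at_right (0::real)"
    have pos: "\<forall>\<^sub>F t in ?F. 0 < t"
      by (simp add: eventually_at_right_less)
    \<comment> \<open>For \<open>0 \<le> s \<le> t < d / 2\<close> the point \<open>(s, t - s)\<close> is within \<open>d\<close> of the origin, so the integrand is
      uniformly close to \<open>K x\<close>, and so is its mean.\<close>
    have avg_lim: "((\<lambda>t. ?avg t x) \<longlongrightarrow> K x) ?F"
    proof (rule tendstoI)
      fix e :: real assume "0 < e"
      have "continuous (at (0, 0)) (\<lambda>p. flow \<L> (fst p) (K (flow \<L> (snd p) x)))"
        using cont[of x] by (simp add: continuous_on_eq_continuous_at)
      then obtain d where d: "0 < d" and
        close: "\<And>p. dist p (0, 0) < d \<Longrightarrow> dist (flow \<L> (fst p) (K (flow \<L> (snd p) x))) (K x) < e / 2"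
        using \<open>0 < e\<close> unfolding continuous_at_eps_delta
        by (metis flow_0[OF L] fst_conv snd_conv half_gt_zero)
      have "\<forall>\<^sub>F t in ?F. t < d / 2"
        using d by (intro eventually_at_rightI[of 0 "d / 2"]) auto
      then show "\<forall>\<^sub>F t in ?F. dist (?avg t x) (K x) < e"
        using pos
      proof eventually_elim
        case (elim t)
        let ?k = "\<lambda>s. flow \<L> s (K (flow \<L> (t - s) x))"
        have i: "((\<lambda>s. ?w t s *\<^sub>R (?k s - K x)) has_integral ?avg t x - K x) {0..t}"
          using has_integral_diff[OF int_avg[OF elim(2), of x]
              has_integral_linear[OF exp_weight_has_integral[OF \<beta> elim(2)] bounded_linear_scaleR_left], of "K x"]
          by (simp add: o_def scaleR_diff_right)
        have w: "((\<lambda>s. ?w t s * (e / 2)) has_integral 1 * (e / 2)) {0..t}"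
          by (intro has_integral_mult_left exp_weight_has_integral \<beta> elim)
        have "norm (integral {0..t} (\<lambda>s. ?w t s *\<^sub>R (?k s - K x))) \<le> integral {0..t} (\<lambda>s. ?w t s * (e / 2))"
        proof (rule integral_norm_bound_integral)
          fix s assume s: "s \<in> {0..t}"
          have "dist (s, t - s) (0, 0) \<le> \<bar>s\<bar> + \<bar>t - s\<bar>"
            using norm_Pair_le[of s "t - s"] by (simp add: dist_norm flip: zero_prod_def)
          also have "\<dots> < d" using s elim d by simp
          finally have "norm (?k s - K x) \<le> e / 2"
            using close[of "(s, t - s)"] by (simp add: dist_norm)
          then show "norm (?w t s *\<^sub>R (?k s - K x)) \<le> ?w t s * (e / 2)"
            using exp_weight_nonneg[of t \<beta> s] elim
            by (simp only: norm_scaleR abs_of_nonneg less_imp_le mult_left_mono)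
        qed (use i w in \<open>auto simp: has_integral_integrable\<close>)
        then show ?case
          using integral_unique[OF i] integral_unique[OF w] \<open>0 < e\<close> by (simp add: dist_norm)
      qed
    qed
    have u: "((\<lambda>t. flow \<L> t x) has_vector_derivative - \<L> x) (at 0)"
      using flow_has_vector_derivative[OF L, of x 0] by (simp add: flow_0[OF L])
    have u_lim: "((\<lambda>t. flow \<L> t x) \<longlongrightarrow> x) ?F"
      using has_vector_derivative_continuous[OF u] flow_0[OF L, of x]
      by (metis continuous_within filterlim_at_split isCont_def)
    have e: "((\<lambda>t. exp (- 2 * \<beta> * t)) has_real_derivative - 2 * \<beta>) (at 0)"
      by (auto intro!: derivative_eq_intros)
    have gap: "((\<lambda>t. ?gap t x) has_vector_derivative
        2 *\<^sub>R (grad_form2 \<L> x x - \<beta> *\<^sub>R ?G x)) (at 0)"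
    proof -
      have "((\<lambda>t. ?gap t x) has_vector_derivative
        (exp (- 2 * \<beta> * 0) *\<^sub>R (- flow \<L> 0 (\<L> (?G x))) + (- 2 * \<beta>) *\<^sub>R flow \<L> 0 (?G x))
        - (grad_form \<L> (flow \<L> 0 x) (- \<L> x) + grad_form \<L> (- \<L> x) (flow \<L> 0 x))) (at 0)"
        by (intro has_vector_derivative_diff has_vector_derivative_scaleR e flow_has_vector_derivative L
          bounded_bilinear.has_vector_derivative[OF bounded_bilinear_grad_form[OF L]] u)
      moreover have "exp (- 2 * \<beta> * 0) *\<^sub>R (- flow \<L> 0 (\<L> (?G x))) + (- 2 * \<beta>) *\<^sub>R flow \<L> 0 (?G x)
          - (grad_form \<L> (flow \<L> 0 x) (- \<L> x) + grad_form \<L> (- \<L> x) (flow \<L> 0 x))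
        = 2 *\<^sub>R (grad_form2 \<L> x x - \<beta> *\<^sub>R ?G x)"
        by (simp add: flow_0[OF L] grad_form2_def scaleR_diff_right
            bounded_bilinear.minus_left[OF bounded_bilinear_grad_form[OF L]]
            bounded_bilinear.minus_right[OF bounded_bilinear_grad_form[OF L]])
      ultimately show ?thesis by (simp only:)
    qed
    have gap_lim: "((\<lambda>t. (1 / t) *\<^sub>R ?gap t x) \<longlongrightarrow> 2 *\<^sub>R (grad_form2 \<L> x x - \<beta> *\<^sub>R ?G x)) ?F"
      by (rule has_vector_derivative_imp_quotient_tendsto[OF gap]) (simp add: flow_0[OF L])
    have "(?c has_vector_derivative 2 * \<kappa>) (at 0)"
      unfolding has_real_derivative_iff_has_vector_derivative[symmetric]
      using \<beta> by (auto intro!: derivative_eq_intros)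
    then have c_lim: "((\<lambda>t. (1 / t) * ?c t) \<longlongrightarrow> 2 * \<kappa>) ?F"
      using has_vector_derivative_imp_quotient_tendsto[of ?c "2 * \<kappa>"] by simp
    have lin: "((\<lambda>t. \<L> (flow \<L> t x) + ?avg t x) \<longlongrightarrow> \<L> x + K x) ?F"
      by (intro tendsto_add avg_lim bounded_linear.tendsto[OF linear_conv_bounded_linear[THEN iffD1, OF L] u_lim])
    have sq_lim: "((\<lambda>t. abs_sq (\<L> (flow \<L> t x) + ?avg t x)) \<longlongrightarrow> abs_sq (\<L> x + K x)) ?F"
      unfolding abs_sq_def
      by (intro bounded_bilinear.tendsto[OF bounded_bilinear_mult] lin
          bounded_linear.tendsto[OF linear_conv_bounded_linear[THEN iffD1, OF linear_cadj]])
    have "psd (2 *\<^sub>R (grad_form2 \<L> x x - \<beta> *\<^sub>R ?G x) - (2 * \<kappa>) *\<^sub>R abs_sq (\<L> x + K x))"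
    proof (rule psd_limit)
      show "((\<lambda>t. (1 / t) *\<^sub>R ?gap t x - ((1 / t) * ?c t) *\<^sub>R abs_sq (\<L> (flow \<L> t x) + ?avg t x))
        \<longlongrightarrow> 2 *\<^sub>R (grad_form2 \<L> x x - \<beta> *\<^sub>R ?G x) - (2 * \<kappa>) *\<^sub>R abs_sq (\<L> x + K x)) ?F"
        by (intro tendsto_diff gap_lim tendsto_scaleR c_lim sq_lim)
      show "\<forall>\<^sub>F t in ?F. psd ((1 / t) *\<^sub>R ?gap t x - ((1 / t) * ?c t) *\<^sub>R abs_sq (\<L> (flow \<L> t x) + ?avg t x))"
        using pos
      proof eventually_elim
        case (elim t)
        have "psd ((1 / t) *\<^sub>R (?gap t x - ?c t *\<^sub>R abs_sq (\<L> (flow \<L> t x) + ?avg t x)))"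
          using \<open>?est\<close> elim unfolding est by (intro psd_scaleR) auto
        then show ?case by (simp only: scaleR_diff_right scaleR_scaleR)
      qed
    qed simp
    from psd_scaleR[OF _ this, of "1 / 2"]
    show "\<beta> *\<^sub>R ?G x + \<kappa> *\<^sub>R abs_sq (\<L> x + K x) \<preceq> grad_form2 \<L> x x"
      by (simp add: loewner_le_def scaleR_diff_right scaleR_add_right diff_diff_eq)
  qed
  ultimately show ?thesis by blast
qed

theorem theorem4p16:
  fixes \<Phi> :: "real \<Rightarrow> 'n::finite cmat \<Rightarrow> 'n cmat"
    and \<L> :: "'n cmat \<Rightarrow> 'n cmat"
    and \<Delta> :: "(('n \<times> 'n) \<times> ('n \<times> 'n)) cmat"
    and m :: nat
    and p :: "nat \<Rightarrow> (('n \<times> 'n) \<times> ('n \<times> 'n)) cmat"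
    and \<mu> :: "nat \<Rightarrow> real"
    and \<beta> :: real
  assumes "quantum_Markov_semigroup \<Phi> \<L>"
    and "bimodule_GNS_symmetric \<Phi> \<L> \<Delta>"
    and "modular_data \<L> \<Delta> m p \<mu>"
    and "\<beta> \<noteq> 0"
  shows
    "(\<forall>x. \<forall>t>0.
        grad_form \<L> (\<Phi> t x) (\<Phi> t x) \<preceq>
          exp (- 2 * \<beta> * t) *\<^sub>R \<Phi> t (grad_form \<L> x x)
          - ((1 - exp (- 2 * \<beta> * t)) / (\<beta> * (\<Sum>j=1..m. (1 + \<mu> j)\<^sup>2))) *\<^sub>R
              abs_sq (\<L> (\<Phi> t x) +
                integral {0..t} (\<lambda>s.
                  (2 * \<beta> * exp (- 2 * \<beta> * s) / (1 - exp (- 2 * \<beta> * t))) *\<^sub>R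
                    (\<Phi> s (L2_adjoint \<L> (\<Phi> (t - s) x)) +
                     \<Phi> s (A_map \<L> (\<Phi> (t - s) x))))))
     \<longleftrightarrow>
     (\<forall>x.
        \<beta> *\<^sub>R grad_form \<L> x x
        + (1 / (\<Sum>j=1..m. (1 + \<mu> j)\<^sup>2)) *\<^sub>R
            abs_sq (\<L> x + L2_adjoint \<L> x + A_map \<L> x)
        \<preceq> grad_form2 \<L> x x)"
proof -
  let ?K = "\<lambda>x. L2_adjoint \<L> x + A_map \<L> x"
  let ?\<kappa> = "1 / (\<Sum>j=1..m. (1 + \<mu> j)\<^sup>2)"
  have "clinear_map \<L>"
    using assms(1) by (simp add: quantum_Markov_semigroup_def)
  then have K: "linear ?K"
    by (intro linear_compose_add linear_L2_adjoint linear_A_map)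
  have \<kappa>: "0 \<le> ?\<kappa>"
    by (intro divide_nonneg_nonneg sum_nonneg) auto
  \<comment> \<open>If \<open>m = 0\<close>, the sum is empty and both coefficients are \<open>0\<close>, in accordance with \<open>a / 0 = 0\<close>.\<close>
  have c: "(1 - exp (- 2 * \<beta> * t)) / (\<beta> * (\<Sum>j=1..m. (1 + \<mu> j)\<^sup>2))
      = (1 - exp (- 2 * \<beta> * t)) / \<beta> * ?\<kappa>" for t
    by simp
  have split: "integral {0..t} (\<lambda>s. w s *\<^sub>R (\<Phi> s (L2_adjoint \<L> (\<Phi> (t - s) x)) + \<Phi> s (A_map \<L> (\<Phi> (t - s) x))))
      = integral {0..t} (\<lambda>s. w s *\<^sub>R \<Phi> s (?K (\<Phi> (t - s) x)))" for w and t :: real and x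
    by (rule integral_cong)
      (simp add: quantum_Markov_semigroup_flow[OF assms(1)]
        linear_add[OF linear_flow[OF quantum_Markov_semigroup_linear[OF assms(1)]]])
  show ?thesis
    unfolding c split add.assoc by (rule gradient_estimate_iff[OF assms(1) K assms(4) \<kappa>])
qed

end
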